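(* Let $m=m(n)=O(n)$, let $G=G(n,m)$, and let $\mathbf D=(d_G(1),\dots,d_G(n))$ be its degree sequence. Throw $2m$ balls independently and uniformly at random into $n$ bins and let $\mathbf Z=(Z_1,\dots,Z_n)$ be the vector of loads (number of balls in each bin). Let $\varepsilon>0$. Then (1) $\mathbf D$ is contiguous with respect to $\mathbf Z$; (2) with high probability $\lfloor\nu(n,2m)-\varepsilon\rfloor\le\Delta(G)\le\lfloor\nu(n,2m)+\varepsilon\rfloor$.
   Context: $G(n,m)$ is a graph chosen uniformly at random among all simple graphs on vertex set $[n]$ with exactly $m$ edges; $d_G(v)$ is the degree of $v$ and $\Delta(G)$ the maximum degree. For random variables $Y=Y(n)$, $Z=Z(n)$ with values in a finite set $S(n)$, $Z$ is contiguous with respect to $Y$ if for every sequence $I(n)\subseteq S(n)$, $\Pr(Y\in I)\to1$ implies $\Pr(Z\in I)\to1$. "With high probability" means with probability tending to $1$ as $n\to\infty$. For $n,k\in\mathbb N$, $\nu(n,k)$ is the unique positive zero of $f_{n,k}(x)=x\log k+x-(x+1/2)\log x-(x-1)\log n$ ($\log$ natural). *)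

theory Defs
  imports "HOL-Probability.Probability" "HOL-Library.Landau_Symbols"
begin

text \<open>A simple graph on the vertex set $[n]$ is identified with its edge set,
  a set of two-element subsets of $\{1,\dots,n\}$.\<close>

definition simple_graphs :: "nat \<Rightarrow> nat \<Rightarrow> nat set set set" where
  "simple_graphs n m = {E. E \<subseteq> {e. e \<subseteq> {1..n} \<and> card e = 2} \<and> card E = m}"

text \<open>Meaningful only if $m \le {n \choose 2}$, since otherwise there is no such graph. If
  $m = O(n)$, this can fail for finitely many $n$ only.\<close>

definition gnm :: "nat \<Rightarrow> nat \<Rightarrow> nat set set pmf" where
  "gnm n m = pmf_of_set (simple_graphs n m)"

definition degree :: "nat set set \<Rightarrow> nat \<Rightarrow> nat" where
  "degree E v = card {e \<in> E. v \<in> e}"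

definition max_degree :: "nat \<Rightarrow> nat set set \<Rightarrow> nat" where
  "max_degree n E = Max (degree E ` {1..n})"

definition degree_sequence :: "nat \<Rightarrow> nat set set \<Rightarrow> nat \<Rightarrow> nat" where
  "degree_sequence n E = restrict (degree E) {1..n}"

text \<open>A throw of $k$ balls into $n$ bins maps each ball to its bin; the balls are independent.\<close>

definition balls_into_bins :: "nat \<Rightarrow> nat \<Rightarrow> (nat \<Rightarrow> nat) pmf" where
  "balls_into_bins n k = Pi_pmf {1..k} 0 (\<lambda>_. pmf_of_set {1..n})"

definition loads :: "nat \<Rightarrow> nat \<Rightarrow> (nat \<Rightarrow> nat) \<Rightarrow> nat \<Rightarrow> nat" where
  "loads n k a = restrict (\<lambda>j. card {i \<in> {1..k}. a i = j}) {1..n}"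

text \<open>Contiguity depends on the random variables through their laws only:
  \<open>Z n\<close> and \<open>Y n\<close> are the laws of random variables with values in the finite set \<open>S n\<close>.\<close>

definition contiguous_wrt ::
  "(nat \<Rightarrow> 'a set) \<Rightarrow> (nat \<Rightarrow> 'a pmf) \<Rightarrow> (nat \<Rightarrow> 'a pmf) \<Rightarrow> bool" where
  "contiguous_wrt S Z Y \<longleftrightarrow>
     (\<forall>I. (\<forall>n. I n \<subseteq> S n) \<longrightarrow>
          (\<lambda>n. measure_pmf.prob (Y n) (I n)) \<longlonglongrightarrow> 1 \<longrightarrow>
          (\<lambda>n. measure_pmf.prob (Z n) (I n)) \<longlonglongrightarrow> 1)"

definition nu_fun :: "nat \<Rightarrow> nat \<Rightarrow> real \<Rightarrow> real" where
  "nu_fun n k x =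
     x * ln (real k) + x - (x + 1 / 2) * ln x - (x - 1) * ln (real n)"

text \<open>For $k = 0$ the convention \<open>ln 0 = 0\<close> gives \<open>nu n 0 = nu n 1\<close>.\<close>

definition nu :: "nat \<Rightarrow> nat \<Rightarrow> real" where
  "nu n k = (THE x. 0 < x \<and> nu_fun n k x = 0)"

text \<open>Sanity checks: the zero defining \<open>nu\<close> exists uniquely, and degree sequences and load
  vectors take values in a common finite set.\<close>

lemma nu_fun_deriv:
  assumes "0 < x" "0 < n" "0 < k"
  shows "(nu_fun n k has_real_derivative
           (ln (real k) - ln (real n) - ln x - 1 / (2 * x))) (at x)"
proof -
  have "((\<lambda>x. x * ln (real k) + x - (x + 1 / 2) * ln x - (x - 1) * ln (real n))
          has_real_derivative (ln (real k) - ln (real n) - ln x - 1 / (2 * x))) (at x)"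
    using assms by (auto intro!: derivative_eq_intros simp: field_simps)
  thus ?thesis unfolding nu_fun_def .
qed

lemma ln_plus_inverse_mono:
  assumes "1 \<le> x" "x < (y::real)"
  shows "ln x + 1 / (2 * x) < ln y + 1 / (2 * y)"
proof (rule DERIV_pos_imp_increasing[OF assms(2)])
  fix t assume "x \<le> t" "t \<le> y"
  hence "((\<lambda>x. ln x + 1 / (2 * x)) has_real_derivative (1 / t - 1 / (2 * t\<^sup>2))) (at t)"
    using assms by (auto intro!: derivative_eq_intros simp: field_simps power2_eq_square)
  moreover have "1 / t - 1 / (2 * t\<^sup>2) > 0"
    using \<open>x \<le> t\<close> assms by (simp add: field_simps power2_eq_square)
  ultimately show "\<exists>y. ((\<lambda>x. ln x + 1 / (2 * x)) has_real_derivative y) (at t) \<and> 0 < y" by blast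
qed

lemma nu_fun_unique_zero:
  assumes n: "0 < n" and k: "0 < k"
  shows "\<exists>!x. 0 < x \<and> nu_fun n k x = 0"
proof -
  define L where "L = ln (real k) - ln (real n)"
  have f: "nu_fun n k x = x * L + x - (x + 1 / 2) * ln x + ln (real n)" for x
    by (simp add: nu_fun_def L_def algebra_simps)
  have der: "(nu_fun n k has_real_derivative (L - (ln x + 1 / (2 * x)))) (at x)" if "0 < x" for x
    using nu_fun_deriv[OF that n k] by (simp add: L_def algebra_simps)
  have cont: "continuous_on {a..b} (nu_fun n k)" if "0 < a" for a b
    by (rule continuous_at_imp_continuous_on)
       (use that in \<open>auto intro!: DERIV_isCont der\<close>)
  have f1: "0 < nu_fun n k 1"
  proof -
    have "0 \<le> ln (real k)" using k by simp
    thus ?thesis by (simp add: nu_fun_def)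
  qed
  have pos: "0 < nu_fun n k x" if x: "0 < x" "x \<le> 1" for x
  proof -
    have "nu_fun n k x = x * ln (real k) + x - (x + 1/2) * ln x + (1 - x) * ln (real n)"
      by (simp add: nu_fun_def algebra_simps)
    moreover have "0 \<le> x * ln (real k)" using x k by simp
    moreover have "(x + 1/2) * ln x \<le> 0" using x by (intro mult_nonneg_nonpos) auto
    moreover have "0 \<le> (1 - x) * ln (real n)" using x n by simp
    ultimately show ?thesis using x by linarith
  qed
  have ex: "\<exists>x\<ge>1. nu_fun n k x = 0"
  proof -
    define M where "M = exp (\<bar>L\<bar> + 1 + ln (real n))"
    have M1: "1 \<le> M" using n by (simp add: M_def)
    have lnM: "ln M = \<bar>L\<bar> + 1 + ln (real n)" by (simp add: M_def)
    have "M * L \<le> M * \<bar>L\<bar>" using M1 by (intro mult_left_mono) auto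
    moreover have "ln (real n) \<le> M * ln (real n)"
      using M1 n by (simp add: mult_le_cancel_right1)
    moreover have "0 \<le> ln M" using M1 by simp
    moreover have "nu_fun n k M = M * L + M - M * \<bar>L\<bar> - M - M * ln (real n) - ln M / 2 + ln (real n)"
      unfolding f lnM by (simp add: field_simps)
    ultimately have "nu_fun n k M \<le> 0" by linarith
    then obtain x where "1 \<le> x" "x \<le> M" "nu_fun n k x = 0"
      using IVT2'[of "nu_fun n k" M 0 1] f1 M1 cont[of 1 M] by auto
    thus ?thesis by blast
  qed
  have no2: False if xy: "0 < x" "x < y" and z: "nu_fun n k x = 0" "nu_fun n k y = 0" for x y
  proof -
    have x1: "1 < x" using pos[of x] xy z by force
    obtain s where s: "1 < s" "s < x" "nu_fun n k x - nu_fun n k 1 = (x - 1) * (L - (ln s + 1 / (2 * s)))"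
      using MVT2[OF x1, of "nu_fun n k" "\<lambda>x. L - (ln x + 1 / (2 * x))"] der by force
    obtain t where t: "x < t" "t < y" "nu_fun n k y - nu_fun n k x = (y - x) * (L - (ln t + 1 / (2 * t)))"
      using MVT2[OF xy(2), of "nu_fun n k" "\<lambda>x. L - (ln x + 1 / (2 * x))"] der x1 by force
    have "(x - 1) * (L - (ln s + 1 / (2 * s))) < 0" using s(3) z f1 by linarith
    hence "L < ln s + 1 / (2 * s)" using x1 by (simp add: mult_less_0_iff)
    moreover have "L = ln t + 1 / (2 * t)" using t z xy by simp
    moreover have "ln s + 1 / (2 * s) < ln t + 1 / (2 * t)"
      using ln_plus_inverse_mono[of s t] s t by simp
    ultimately show False by linarith
  qed
  from ex obtain x where "1 \<le> x" "nu_fun n k x = 0" by blast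
  thus ?thesis
    by (intro ex1I[of _ x]) (auto, metis no2 linorder_neqE_linordered_idom order_less_le_trans zero_less_one)
qed

lemma finite_simple_graphs: "finite (simple_graphs n m)"
  by (rule finite_subset[of _ "Pow (Pow {1..n})"]) (auto simp: simple_graphs_def)

lemma simple_graphs_nonempty:
  assumes "m \<le> n choose 2"
  shows "simple_graphs n m \<noteq> {}"
proof -
  have "m \<le> card {e. e \<subseteq> {1..n} \<and> card e = 2}"
    using assms by (simp add: n_subsets)
  then obtain E where "E \<subseteq> {e. e \<subseteq> {1..n} \<and> card e = 2}" "card E = m"
    by (meson obtain_subset_with_card_n)
  thus ?thesis by (auto simp: simple_graphs_def)
qed

lemma degree_sequence_range:
  assumes "E \<in> simple_graphs n m"
  shows "degree_sequence n E \<in> {1..n} \<rightarrow>\<^sub>E {..2 * m}"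
proof -
  have "finite E"
    by (rule finite_subset[of _ "Pow {1..n}"]) (use assms in \<open>auto simp: simple_graphs_def\<close>)
  hence "degree E v \<le> m" for v
    using assms card_mono[of E "{e \<in> E. v \<in> e}"] by (auto simp: degree_def simple_graphs_def)
  thus ?thesis
    by (auto simp: degree_sequence_def intro: order.trans[of _ m])
qed

lemma loads_range: "loads n k a \<in> {1..n} \<rightarrow>\<^sub>E {..k}"
proof -
  have "card {i \<in> {1..k}. a i = j} \<le> k" for j
    using card_mono[OF finite_atLeastAtMost, of "{i \<in> {1..k}. a i = j}" 1 k] by fastforce
  thus ?thesis by (auto simp: loads_def)
qed

end

theory Submission
  imports Defs "HOL-Real_Asymp.Real_Asymp"
begin

text \<open>
  Joining balls \<open>2 * i + 1\<close> and \<open>2 * i + 2\<close> by an edge turns a throw of \<open>2 * m\<close> balls into a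
  multigraph whose degrees are the loads. Every simple graph with \<open>m\<close> edges arises from exactly
  \<open>m! * 2 ^ m\<close> throws, so \<open>G(n, m)\<close> is this multigraph conditioned on being simple, and for
  \<open>m = O(n)\<close> the probability of being simple is bounded away from 0. Hence probabilities for degree
  sequences are at most a constant times those for load vectors; this gives contiguity and reduces
  the second claim to the maximum load.

  With \<open>k = 2 * m\<close>, the expected number of bins with load \<open>d\<close> is, up to constant factors,
  \<open>exp (nu_fun n k d)\<close> by Stirling, and the first and second moment methods show that the maximum
  load is determined by whether \<open>nu_fun n k d\<close> tends to plus or minus infinity. Since \<open>nu_fun n k\<close>
  is concave on \<open>[1, \<infinity>)\<close>, with value \<open>1 + ln k\<close> at 1 and zero \<open>nu n k\<close>, its modulus at distance at
  least \<open>\<epsilon>\<close> from the zero is at least \<open>\<epsilon> * (1 + ln k) / (nu n k - 1)\<close>, where \<open>nu n k = o(ln n)\<close>.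
  If \<open>k\<close> is so small that \<open>ln k\<close> is not of order \<open>ln n\<close>, no bin receives two balls.
\<close>

section \<open>The configuration model\<close>

text \<open>The default value 0 outside the balls is that of \<open>balls_into_bins\<close>, so this
  is the support of that distribution; 0 is not a bin.\<close>

definition throws :: "nat \<Rightarrow> nat \<Rightarrow> (nat \<Rightarrow> nat) set" where
  "throws n k = PiE_dflt {1..k} 0 (\<lambda>_. {1..n})"

lemma throws_iff: "a \<in> throws n k \<longleftrightarrow> (\<forall>i. a i \<in> (if i \<in> {1..k} then {1..n} else {0}))"
  unfolding throws_def PiE_dflt_def mem_Collect_eq by (intro arg_cong[of _ _ All] ext) auto

lemma card_throws: "card (throws n k) = n ^ k"
  unfolding throws_def by (subst card_PiE_dflt) auto

lemma finite_throws: "finite (throws n k)"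
  unfolding throws_def by (rule finite_PiE_dflt) auto

lemma balls_into_bins_uniform:
  assumes "0 < n"
  shows "balls_into_bins n k = pmf_of_set (throws n k)"
  unfolding balls_into_bins_def throws_def using assms by (intro Pi_pmf_of_set) auto

lemma throws_nonempty: "0 < n \<Longrightarrow> throws n k \<noteq> {}"
  using card_throws[of n k] by auto

section \<open>Throws that enumerate a given simple graph\<close>

definition edges_of_throw :: "nat \<Rightarrow> (nat \<Rightarrow> nat) \<Rightarrow> nat set set" where
  "edges_of_throw m a = (\<lambda>i. {a (2 * i + 1), a (2 * i + 2)}) ` {..<m}"

text \<open>The throws that yield the simple graph \<open>E\<close>, described by recursion on the last edge.\<close>

fun edge_enumerations :: "nat \<Rightarrow> nat set set \<Rightarrow> (nat \<Rightarrow> nat) set" where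
  "edge_enumerations 0 E = (if E = {} then {\<lambda>_. 0} else {})"
| "edge_enumerations (Suc m) E =
     (\<Union>(u, v) \<in> {(u, v). {u, v} \<in> E \<and> u \<noteq> v}.
        (\<lambda>a. a(2 * m + 1 := u, 2 * m + 2 := v)) ` edge_enumerations m (E - {{u, v}}))"

lemma simple_graph_remove_edge:
  assumes "E \<in> simple_graphs n (Suc m)" "e \<in> E"
  shows "E - {e} \<in> simple_graphs n m"
proof -
  have "card (E - {e}) = m" using assms by (simp add: simple_graphs_def card_Diff_singleton)
  thus ?thesis using assms(1) unfolding simple_graphs_def by blast
qed

lemma simple_graph_finite: "E \<in> simple_graphs n m \<Longrightarrow> finite E"
  by (rule finite_subset[of _ "Pow {1..n}"]) (auto simp: simple_graphs_def)

lemma edge_enumerations_subset_throws: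
  assumes "E \<in> simple_graphs n m"
  shows "edge_enumerations m E \<subseteq> throws n (2 * m)"
  using assms
proof (induction m arbitrary: E)
  case 0
  show ?case by (auto simp: throws_def PiE_dflt_def)
next
  case (Suc m)
  show ?case
  proof
    fix b assume "b \<in> edge_enumerations (Suc m) E"
    then obtain u v a where uv: "{u, v} \<in> E" and a: "a \<in> edge_enumerations m (E - {{u, v}})"
      and b: "b = a(2 * m + 1 := u, 2 * m + 2 := v)" by auto
    have aT: "a \<in> throws n (2 * m)"
      using Suc.IH[OF simple_graph_remove_edge[OF Suc.prems uv]] a by blast
    have "{u, v} \<subseteq> {1..n}" using uv Suc.prems unfolding simple_graphs_def by blast
    hence uv': "u \<in> {1..n}" "v \<in> {1..n}" by blast+
    have "b i \<in> (if i \<in> {1..2 * Suc m} then {1..n} else {0})" for i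
    proof -
      consider "i = 2 * m + 1" | "i = 2 * m + 2" | "i \<in> {1..2 * m}" | "i \<notin> {1..2 * Suc m}" by force
      thus ?thesis
      proof cases
        case 3
        hence "a i \<in> {1..n}" using aT by (simp add: throws_def PiE_dflt_def)
        thus ?thesis using 3 by (simp add: b)
      next
        case 4
        hence "i \<notin> {1..2 * m}" by auto
        hence "a i = 0" using aT by (simp add: throws_def PiE_dflt_def)
        thus ?thesis using 4 by (auto simp: b)
      qed (use uv' in \<open>simp_all add: b\<close>)
    qed
    thus "b \<in> throws n (2 * Suc m)"
      unfolding throws_iff by (rule allI)
  qed
qed

text \<open>An enumeration determines its graph, so the enumerations of distinct graphs form
  disjoint sets of throws; the count of throws rests on this.\<close>

lemma edges_of_throw_enumeration:
  "a \<in> edge_enumerations m E \<Longrightarrow> edges_of_throw m a = E"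
proof (induction m arbitrary: a E)
  case 0
  thus ?case by (auto simp: edges_of_throw_def split: if_splits)
next
  case (Suc m)
  then obtain u v b where uv: "{u, v} \<in> E" and b: "b \<in> edge_enumerations m (E - {{u, v}})"
    and a: "a = b(2 * m + 1 := u, 2 * m + 2 := v)" by auto
  \<comment> \<open>The two overwritten positions belong to the edge with index \<open>m\<close>,
    and only indices below \<open>m\<close> are read here.\<close>
  have "edges_of_throw m a = edges_of_throw m b"
    unfolding edges_of_throw_def a by (intro image_cong) auto
  hence "edges_of_throw m a = E - {{u, v}}" using Suc.IH[OF b] by simp
  moreover have "edges_of_throw (Suc m) a = insert {u, v} (edges_of_throw m a)"
    unfolding edges_of_throw_def lessThan_Suc image_insert by (simp add: a)
  ultimately show ?case using uv by auto
qed

text \<open>Induction on the last edge: its two balls raise the loads of \<open>u\<close> and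
  \<open>v\<close> by one each, exactly as the edge raises their degrees. Since
  \<open>u \<noteq> v\<close>, no bin receives both balls.\<close>

lemma card_preimage_enumeration:
  assumes "a \<in> edge_enumerations m E" "E \<in> simple_graphs n m"
  shows "card {i \<in> {1..2 * m}. a i = x} = degree E x"
  using assms
proof (induction m arbitrary: a E)
  case 0
  thus ?case by (auto simp: degree_def split: if_splits)
next
  case (Suc m)
  from Suc.prems obtain u v b where uv: "{u, v} \<in> E" "u \<noteq> v"
    and b: "b \<in> edge_enumerations m (E - {{u, v}})"
    and a: "a = b(2 * m + 1 := u, 2 * m + 2 := v)" by auto
  have IH: "card {i \<in> {1..2 * m}. b i = x} = degree (E - {{u, v}}) x"
    using Suc.IH[OF b simple_graph_remove_edge[OF Suc.prems(2) uv(1)]] .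
  have "{1..2 * Suc m} = insert (2 * m + 2) (insert (2 * m + 1) {1..2 * m})" by auto
  hence "{i \<in> {1..2 * Suc m}. a i = x} = {i \<in> {1..2 * m}. b i = x} \<union>
           ((if u = x then {2 * m + 1} else {}) \<union> (if v = x then {2 * m + 2} else {}))"
    by (auto simp: a)
  also have "card \<dots> = card {i \<in> {1..2 * m}. b i = x} + (if x \<in> {u, v} then 1 else 0)"
    using uv(2) by (subst card_Un_disjoint) auto
  also have "\<dots> = degree (E - {{u, v}}) x + (if x \<in> {u, v} then 1 else 0)"
    by (simp only: IH)
  also have "\<dots> = degree E x"
  proof -
    have "{e \<in> E. x \<in> e} =
        {e \<in> E - {{u, v}}. x \<in> e} \<union> (if x \<in> {u, v} then {{u, v}} else {})"
      using uv by auto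
    moreover have "card \<dots> = card {e \<in> E - {{u, v}}. x \<in> e} + (if x \<in> {u, v} then 1 else 0)"
      using simple_graph_finite[OF Suc.prems(2)] by (subst card_Un_disjoint) auto
    ultimately show ?thesis by (simp add: degree_def)
  qed
  finally show ?case .
qed

lemma loads_enumeration:
  assumes "a \<in> edge_enumerations m E" "E \<in> simple_graphs n m"
  shows "loads n (2 * m) a = degree_sequence n E"
  using card_preimage_enumeration[OF assms] by (simp add: loads_def degree_sequence_def)

text \<open>The pairs are the choices for the last two balls in the recursion of
  \<open>edge_enumerations\<close>; the two orientations of an edge account for a factor 2 per
  edge.\<close>

lemma card_oriented_edges:
  assumes "finite E" "\<And>e. e \<in> E \<Longrightarrow> card e = 2"
  shows "finite {(u, v). {u, v} \<in> E \<and> u \<noteq> v}"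
    and "card {(u, v). {u, v} \<in> E \<and> u \<noteq> v} = 2 * card E"
proof -
  have U: "{(u, v). {u, v} \<in> E \<and> u \<noteq> v} = (\<Union>e\<in>E. {(u, v). {u, v} = e \<and> u \<noteq> v})" by auto
  have two: "finite {(u, v). {u, v} = e \<and> u \<noteq> v} \<and> card {(u, v). {u, v} = e \<and> u \<noteq> v} = 2"
    if e: "e \<in> E" for e
  proof -
    obtain x y where xy: "e = {x, y}" "x \<noteq> y" using assms(2)[OF e] by (auto simp: card_2_iff)
    hence "{(u, v). {u, v} = e \<and> u \<noteq> v} = {(x, y), (y, x)}" by (auto simp: doubleton_eq_iff)
    thus ?thesis using xy by simp
  qed
  show "finite {(u, v). {u, v} \<in> E \<and> u \<noteq> v}"
    unfolding U using assms(1) two by blast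
  show "card {(u, v). {u, v} \<in> E \<and> u \<noteq> v} = 2 * card E"
    unfolding U using two assms(1) by (subst card_UN_disjoint) auto
qed

text \<open>The last two balls can be chosen in \<open>2 * Suc m\<close> ways, and each choice
  leaves a simple graph with \<open>m\<close> edges to be enumerated by the earlier balls.\<close>

lemma card_edge_enumerations:
  assumes "E \<in> simple_graphs n m"
  shows "card (edge_enumerations m E) = fact m * 2 ^ m"
  using assms
proof (induction m arbitrary: E)
  case 0
  hence "E = {}" using simple_graph_finite[OF 0] by (auto simp: simple_graphs_def)
  thus ?case by simp
next
  case (Suc m)
  define P where "P = {(u, v). {u, v} \<in> E \<and> u \<noteq> v}"
  define F where "F = (\<lambda>(u, v). (\<lambda>a. a(2 * m + 1 := u, 2 * m + 2 := v)) `
                         edge_enumerations m (E - {{u, v}}))"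
  have E: "finite E" "card E = Suc m" "\<And>e. e \<in> E \<Longrightarrow> card e = 2"
    using simple_graph_finite[OF Suc.prems] Suc.prems by (auto simp: simple_graphs_def)
  note P = card_oriented_edges[OF E(1,3), folded P_def]
  have sub: "edge_enumerations m (E - {{u, v}}) \<subseteq> throws n (2 * m)" if "(u, v) \<in> P" for u v
    using edge_enumerations_subset_throws[OF simple_graph_remove_edge[OF Suc.prems]] that
    by (auto simp: P_def)
  have cF: "finite (F p) \<and> card (F p) = fact m * 2 ^ m" if "p \<in> P" for p
  proof -
    obtain u v where p: "p = (u, v)" by force
    \<comment> \<open>Overwriting loses no information because a throw of \<open>2 * m\<close> balls
      has the default value 0 at both positions.\<close>
    have "inj_on (\<lambda>a. a(2 * m + 1 := u, 2 * m + 2 := v)) (throws n (2 * m))"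
    proof (rule inj_onI)
      fix a b assume ab: "a \<in> throws n (2 * m)" "b \<in> throws n (2 * m)"
        "a(2 * m + 1 := u, 2 * m + 2 := v) = b(2 * m + 1 := u, 2 * m + 2 := v)"
      show "a = b"
      proof
        fix i
        show "a i = b i"
          using fun_cong[OF ab(3), of i] ab(1,2)
          by (cases "i \<in> {1..2 * m}") (auto simp: throws_def PiE_dflt_def split: if_splits)
      qed
    qed
    hence "inj_on (\<lambda>a. a(2 * m + 1 := u, 2 * m + 2 := v)) (edge_enumerations m (E - {{u, v}}))"
      using sub that p by (meson inj_on_subset)
    moreover have "card (edge_enumerations m (E - {{u, v}})) = fact m * 2 ^ m"
      using that p by (intro Suc.IH simple_graph_remove_edge[OF Suc.prems]) (auto simp: P_def)
    moreover have "finite (edge_enumerations m (E - {{u, v}}))"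
      using sub that p finite_throws finite_subset by metis
    ultimately show ?thesis by (simp add: p F_def card_image)
  qed
  \<comment> \<open>The values at the last two positions recover the pair.\<close>
  have disj: "F p \<inter> F q = {}" if "p \<noteq> q" for p q
  proof -
    have "p = (a (2 * m + 1), a (2 * m + 2))" if "a \<in> F p" for a p
      using that by (cases p) (auto simp: F_def)
    thus ?thesis using that by blast
  qed
  have "edge_enumerations (Suc m) E = (\<Union>p\<in>P. F p)"
    by (simp add: P_def F_def)
  also have "card \<dots> = (\<Sum>p\<in>P. card (F p))"
    by (rule card_UN_disjoint) (use P(1) cF disj in auto)
  also have "\<dots> = (2 * Suc m) * (fact m * 2 ^ m)"
    using cF P(2) E(2) by simp
  finally show ?case by (simp add: algebra_simps)
qed

text \<open>The enumerations of the graphs on the left are disjoint sets of throws with the right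
  loads. Equality can fail, since throws that create loops or repeated edges may have loads in
  \<open>A\<close> too.\<close>

lemma graph_count_le_throw_count:
  "card {E \<in> simple_graphs n m. degree_sequence n E \<in> A} * (fact m * 2 ^ m)
     \<le> card {a \<in> throws n (2 * m). loads n (2 * m) a \<in> A}"
proof -
  let ?S = "{E \<in> simple_graphs n m. degree_sequence n E \<in> A}"
  have fin: "finite (edge_enumerations m E)" if "E \<in> simple_graphs n m" for E
    using edge_enumerations_subset_throws[OF that] finite_throws finite_subset by metis
  have "card ?S * (fact m * 2 ^ m) = (\<Sum>E\<in>?S. card (edge_enumerations m E))"
    by (subst sum.cong[OF refl card_edge_enumerations]) auto
  also have "\<dots> = card (\<Union>E\<in>?S. edge_enumerations m E)"
    by (rule card_UN_disjoint[symmetric])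
       (use finite_simple_graphs fin edges_of_throw_enumeration in \<open>simp, simp, blast\<close>)
  also have "\<dots> \<le> card {a \<in> throws n (2 * m). loads n (2 * m) a \<in> A}"
  proof (rule card_mono)
    show "(\<Union>E\<in>?S. edge_enumerations m E) \<subseteq> {a \<in> throws n (2 * m). loads n (2 * m) a \<in> A}"
      using edge_enumerations_subset_throws loads_enumeration by fastforce
  qed (use finite_throws in simp)
  finally show ?thesis .
qed

section \<open>The probability that the multigraph is simple\<close>

text \<open>The right-hand side is a falling factorial with \<open>m\<close> factors, each at least
  \<open>N - M\<close>. Keeping \<open>M\<close> apart from \<open>m\<close> fixes the base of the
  power during the induction.\<close>

lemma power_le_choose_fact:
  assumes "m \<le> M" "M \<le> N"
  shows "(real N - real M) ^ m \<le> real (N choose m) * fact m"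
  using assms(1)
proof (induction m)
  case 0
  show ?case by simp
next
  case (Suc m)
  have "real (N choose Suc m) * fact (Suc m) = (real (N choose m) * fact m) * (real N - real m)"
  proof -
    have "Suc m * (N choose Suc m) = (N - m) * (N choose m)"
      by (metis binomial_absorb_comp binomial_absorption)
    hence "real (Suc m) * real (N choose Suc m) = real (N - m) * real (N choose m)"
      by (metis of_nat_mult)
    hence "real (Suc m) * real (N choose Suc m) * fact m
        = (real N - real m) * real (N choose m) * fact m"
      using Suc.prems assms(2) by (simp add: of_nat_diff)
    thus ?thesis by (simp only: fact_Suc of_nat_mult mult_ac)
  qed
  moreover have "(real N - real M) ^ m * (real N - real M)
      \<le> (real (N choose m) * fact m) * (real N - real m)"
    using Suc assms(2) by (intro mult_mono) auto
  ultimately show ?case by (simp only: power_Suc2)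
qed

text \<open>Combines \<open>1 \<le> (1 - x) * (1 + 2 * x)\<close> with
  \<open>1 + 2 * x \<le> exp (2 * x)\<close>. It bounds powers of \<open>1 - x\<close> from below by
  exponentials.\<close>

lemma exp_minus_double_le:
  assumes "0 \<le> x" "x \<le> (1/2 :: real)"
  shows "exp (- 2 * x) \<le> 1 - x"
proof -
  have "1 \<le> (1 - x) * (1 + 2 * x)"
  proof -
    have "0 \<le> x * (1 - 2 * x)" using assms by simp
    thus ?thesis by (simp add: algebra_simps)
  qed
  also have "\<dots> \<le> (1 - x) * exp (2 * x)"
    using assms exp_ge_add_one_self[of "2 * x"] by (intro mult_left_mono) auto
  finally show ?thesis by (simp add: exp_minus field_simps)
qed

lemma card_simple_graphs: "card (simple_graphs n m) = (n choose 2) choose m"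
proof -
  have "finite {e. e \<subseteq> {1..n} \<and> card e = 2}" by simp
  from n_subsets[OF this, of m] show ?thesis
    unfolding simple_graphs_def by (simp add: n_subsets)
qed

text \<open>The left-hand side over \<open>n ^ (2 * m)\<close> is the probability that the multigraph of the
  configuration model is simple.\<close>

lemma simple_throws_lower_bound:
  assumes "0 \<le> C" "real m \<le> C * real n" "0 < n" "2 * (1 + 2 * C) \<le> real n"
  shows "exp (- 2 * (1 + 2 * C) * C) * real n ^ (2 * m)
           \<le> real (card (simple_graphs n m)) * (fact m * 2 ^ m)"
proof -
  define N where "N = n choose 2"
  \<comment> \<open>Chosen so that \<open>2 * (N - m) \<ge> n * n - n - 2 * C * n\<close>, which is
    \<open>1 - B / n\<close> times the square of \<open>n\<close>. The last hypothesis says that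
    \<open>B / n \<le> 1/2\<close>, as \<open>exp_minus_double_le\<close> requires.\<close>
  define B where "B = 1 + 2 * C"
  have N: "2 * real N = real n * (real n - 1)"
  proof -
    have "even (n * (n - 1))" by (cases n) auto
    hence "2 * N = n * (n - 1)" by (simp add: N_def choose_two)
    thus ?thesis using assms(3) by (metis One_nat_def Suc_leI of_nat_1 of_nat_diff of_nat_mult of_nat_numeral)
  qed
  have "2 * real m \<le> 2 * (C * real n)" using assms(2) by simp
  also have "\<dots> \<le> real n * (real n - 1)"
  proof -
    have "2 * C \<le> real n - 1" using assms(1,4) by argo
    hence "real n * (2 * C) \<le> real n * (real n - 1)" by (intro mult_left_mono) auto
    thus ?thesis by (simp add: algebra_simps)
  qed
  finally have mN: "m \<le> N" using N by linarith
  have x: "0 \<le> B / real n" "B / real n \<le> 1/2" using assms by (auto simp: B_def field_simps)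
  have "- 2 * B * C \<le> real m * (- 2 * (B / real n))"
  proof -
    have "2 * B * real m \<le> 2 * B * (C * real n)"
      using assms by (intro mult_left_mono) (auto simp: B_def)
    thus ?thesis using assms by (simp add: field_simps)
  qed
  hence "exp (- 2 * B * C) \<le> exp (- 2 * (B / real n)) ^ m"
    by (simp flip: exp_of_nat_mult)
  also have "\<dots> \<le> (1 - B / real n) ^ m"
    using exp_minus_double_le[OF x] by (intro power_mono) auto
  finally have "exp (- 2 * B * C) * real n ^ (2 * m) \<le> (1 - B / real n) ^ m * real n ^ (2 * m)"
    by (intro mult_right_mono) auto
  also have "\<dots> = ((1 - B / real n) * (real n)\<^sup>2) ^ m"
    by (simp add: power_mult power_mult_distrib)
  also have "\<dots> \<le> (2 * (real N - real m)) ^ m"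
  proof (rule power_mono)
    have "(1 - B / real n) * (real n)\<^sup>2 = real n * real n - B * real n"
      using assms(3) by (simp add: power2_eq_square field_simps)
    also have "\<dots> \<le> 2 * (real N - real m)"
      using N assms(2) by (simp add: B_def algebra_simps)
    finally show "(1 - B / real n) * (real n)\<^sup>2 \<le> 2 * (real N - real m)" .
    show "0 \<le> (1 - B / real n) * (real n)\<^sup>2" using x by (intro mult_nonneg_nonneg) (linarith, simp)
  qed
  also have "\<dots> = (real N - real m) ^ m * 2 ^ m" by (simp only: power_mult_distrib mult.commute)
  also have "\<dots> \<le> (real (N choose m) * fact m) * 2 ^ m"
    using power_le_choose_fact[OF order.refl mN] by (intro mult_right_mono) auto
  also have "N choose m = card (simple_graphs n m)"
    by (simp add: card_simple_graphs N_def)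
  finally show ?thesis by (simp add: B_def mult.assoc)
qed

section \<open>Domination of degree sequences by load vectors, and contiguity\<close>

text \<open>Multiply numerator and denominator of the probability for graphs by the number of throws
  per graph: the numerator is then at most the number of throws with loads in \<open>A\<close>, the
  denominator at least a constant fraction of all throws. The constant depends on \<open>C\<close>
  only.\<close>

lemma degree_sequence_prob_le:
  assumes "0 \<le> C" "real m \<le> C * real n" "0 < n" "2 * (1 + 2 * C) \<le> real n"
  shows "measure_pmf.prob (map_pmf (degree_sequence n) (gnm n m)) A
    \<le> exp (2 * (1 + 2 * C) * C) *
       measure_pmf.prob (map_pmf (loads n (2 * m)) (balls_into_bins n (2 * m))) A"
proof -
  define s where "s = real (card (simple_graphs n m))"
  define x where "x = real (card {E \<in> simple_graphs n m. degree_sequence n E \<in> A})"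
  define y where "y = real (card {a \<in> throws n (2 * m). loads n (2 * m) a \<in> A})"
  define f :: real where "f = fact m * 2 ^ m"
  have f: "0 < f" by (simp add: f_def)
  have low: "exp (- 2 * (1 + 2 * C) * C) * real n ^ (2 * m) \<le> s * f"
    using simple_throws_lower_bound[OF assms] by (simp add: s_def f_def)
  have "0 < exp (- 2 * (1 + 2 * C) * C) * real n ^ (2 * m)" using assms(3) by simp
  hence sf: "0 < s * f" using low by linarith
  hence s: "0 < s" using f by (simp add: zero_less_mult_iff)
  \<comment> \<open>The lower bound also shows that graphs with \<open>m\<close> edges exist, so
    \<open>gnm n m\<close> really is uniform.\<close>
  hence ne: "simple_graphs n m \<noteq> {}" by (auto simp: s_def)
  have xy: "x * f \<le> y"
  proof -
    have "f = real (fact m * 2 ^ m)" by (simp add: f_def)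
    thus ?thesis
      using graph_count_le_throw_count[of n m A]
      unfolding x_def y_def by (simp only: of_nat_le_iff flip: of_nat_mult)
  qed
  have "measure_pmf.prob (map_pmf (degree_sequence n) (gnm n m)) A = x / s"
    using measure_pmf_of_set[OF ne finite_simple_graphs]
    by (simp add: gnm_def x_def s_def Int_def vimage_def)
  also have "\<dots> = x * f / (s * f)" using f by simp
  also have "\<dots> \<le> y / (s * f)" using xy sf by (intro divide_right_mono) auto
  also have "\<dots> \<le> y / (exp (- 2 * (1 + 2 * C) * C) * real n ^ (2 * m))"
    using low sf assms(3) by (intro divide_left_mono) (auto simp: y_def)
  also have "\<dots> = exp (2 * (1 + 2 * C) * C) * (y / real n ^ (2 * m))"
  proof -
    have "- 2 * (1 + 2 * C) * C = - (2 * (1 + 2 * C) * C)" by (simp add: algebra_simps)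
    thus ?thesis by (simp only: exp_minus) (simp add: divide_inverse)
  qed
  also have "y / real n ^ (2 * m)
      = measure_pmf.prob (map_pmf (loads n (2 * m)) (balls_into_bins n (2 * m))) A"
    using measure_pmf_of_set[OF throws_nonempty[OF assms(3)] finite_throws]
    by (simp add: balls_into_bins_uniform[OF assms(3)] y_def Int_def vimage_def card_throws)
  finally show ?thesis .
qed

text \<open>The domination is applied to complements: if the complement of \<open>I n\<close> has
  vanishing probability under \<open>Y n\<close>, then also under \<open>Z n\<close>, because
  \<open>K\<close> does not depend on \<open>n\<close>.\<close>

lemma contiguous_wrtI_eventually_le:
  assumes "\<And>A. \<forall>\<^sub>F n in sequentially. measure_pmf.prob (Z n) (A n) \<le> K * measure_pmf.prob (Y n) (A n)"
  shows "contiguous_wrt S Z Y"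
  unfolding contiguous_wrt_def
proof (intro allI impI)
  fix I assume lim: "(\<lambda>n. measure_pmf.prob (Y n) (I n)) \<longlonglongrightarrow> 1"
  have "\<forall>\<^sub>F n in sequentially. 1 - K * (1 - measure_pmf.prob (Y n) (I n)) \<le> measure_pmf.prob (Z n) (I n)"
    using assms[of "\<lambda>n. - I n"]
  proof eventually_elim
    case (elim n)
    have "measure_pmf.prob p (- A) = 1 - measure_pmf.prob p A" for p :: "'a pmf" and A
      using measure_pmf.prob_compl[of A p] by (simp add: Compl_eq_Diff_UNIV)
    thus ?case using elim by simp
  qed
  moreover have "(\<lambda>n. 1 - K * (1 - measure_pmf.prob (Y n) (I n))) \<longlonglongrightarrow> 1 - K * (1 - 1)"
    by (intro tendsto_intros lim)
  ultimately show "(\<lambda>n. measure_pmf.prob (Z n) (I n)) \<longlonglongrightarrow> 1"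
    by (auto intro: tendsto_sandwich[where h = "\<lambda>_. 1"])
qed

section \<open>Moments of the loads\<close>

lemma prob_balls_Pi:
  assumes "0 < n"
  shows "measure_pmf.prob (balls_into_bins n k) (Pi {1..k} B)
           = (\<Prod>i\<in>{1..k}. real (card ({1..n} \<inter> B i)) / real n)"
  unfolding balls_into_bins_def using assms
  by (subst measure_Pi_pmf_Pi) (simp_all add: measure_pmf_of_set)

text \<open>Evaluates the probability that the balls in \<open>S\<close> go to one bin, those in
  \<open>T\<close> to another and the rest elsewhere. With \<open>T\<close> empty it serves for a
  single bin.\<close>

lemma prod_if_if_const:
  fixes x y z :: real
  assumes "finite A" "S \<subseteq> A" "T \<subseteq> A" "S \<inter> T = {}"
  shows "(\<Prod>i\<in>A. if i \<in> S then x else if i \<in> T then y else z)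
           = x ^ card S * y ^ card T * z ^ (card A - card S - card T)"
proof -
  let ?f = "\<lambda>i. if i \<in> S then x else if i \<in> T then y else z"
  have fin: "finite S" "finite T" using assms finite_subset by blast+
  have A: "A = (S \<union> T) \<union> (A - (S \<union> T))" using assms by blast
  have "prod ?f A = prod ?f (S \<union> T) * prod ?f (A - (S \<union> T))"
    by (subst A, subst prod.union_disjoint) (use fin assms in auto)
  also have "prod ?f (S \<union> T) = prod ?f S * prod ?f T"
    by (subst prod.union_disjoint) (use fin assms in auto)
  also have "prod ?f S = x ^ card S" by simp
  also have "prod ?f T = prod (\<lambda>_. y) T" using assms(4) by (intro prod.cong) auto
  also have "prod ?f (A - (S \<union> T)) = prod (\<lambda>_. z) (A - (S \<union> T))" by (intro prod.cong) auto
  also have "card (A - (S \<union> T)) = card A - card S - card T"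
    using assms fin by (subst card_Diff_subset) (auto simp: card_Un_disjoint)
  hence "prod (\<lambda>_. z) (A - (S \<union> T)) = z ^ (card A - card S - card T)" by simp
  finally show ?thesis by simp
qed

text \<open>Agrees with \<open>loads\<close> on \<open>{1..n}\<close>, but is free of
  \<open>n\<close> and of the restriction.\<close>

definition bin_load :: "nat \<Rightarrow> (nat \<Rightarrow> nat) \<Rightarrow> nat \<Rightarrow> nat" where
  "bin_load k a j = card {i \<in> {1..k}. a i = j}"

text \<open>Union bound over the sets of \<open>d\<close> balls that all fall into bin
  \<open>j\<close>.\<close>

lemma prob_load_ge:
  assumes j: "j \<in> {1..n}"
  shows "measure_pmf.prob (balls_into_bins n k) {a. d \<le> bin_load k a j}
           \<le> real (k choose d) * (1 / real n) ^ d"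
proof -
  define I where "I = {S. S \<subseteq> {1..k} \<and> card S = d}"
  \<comment> \<open>The void middle case brings the event into the shape of
    \<open>prod_if_if_const\<close>.\<close>
  define F where "F = (\<lambda>S. Pi {1..k} (\<lambda>i. if i \<in> S then {j} else if i \<in> {} then {} else UNIV))"
  have n: "0 < n" using j by simp
  have I: "finite I" "card I = k choose d" by (simp_all add: I_def n_subsets)
  have "{a. d \<le> bin_load k a j} \<subseteq> (\<Union>S\<in>I. F S)"
  proof
    fix a assume "a \<in> {a. d \<le> bin_load k a j}"
    hence "d \<le> card {i \<in> {1..k}. a i = j}" unfolding bin_load_def by blast
    then obtain S where "S \<subseteq> {i \<in> {1..k}. a i = j}" "card S = d"
      by (rule obtain_subset_with_card_n)
    hence "S \<in> I" "a \<in> F S" by (auto simp: I_def F_def)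
    thus "a \<in> (\<Union>S\<in>I. F S)" by blast
  qed
  hence "measure_pmf.prob (balls_into_bins n k) {a. d \<le> bin_load k a j}
      \<le> measure_pmf.prob (balls_into_bins n k) (\<Union>S\<in>I. F S)"
    by (intro measure_pmf.finite_measure_mono) auto
  also have "\<dots> \<le> (\<Sum>S\<in>I. measure_pmf.prob (balls_into_bins n k) (F S))"
    using I(1) by (intro measure_pmf.finite_measure_subadditive_finite) auto
  also have "\<dots> = (\<Sum>S\<in>I. (1 / real n) ^ d)"
  proof (rule sum.cong[OF refl])
    fix S assume S: "S \<in> I"
    have "measure_pmf.prob (balls_into_bins n k) (F S)
        = (\<Prod>i\<in>{1..k}. if i \<in> S then 1 / real n else if i \<in> {} then 1 else 1)"
      unfolding F_def prob_balls_Pi[OF n]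
      by (intro prod.cong) (use j in auto)
    also have "\<dots> = (1 / real n) ^ card S * 1 ^ card ({}::nat set) * 1 ^ (card {1..k} - card S - card ({}::nat set))"
      by (rule prod_if_if_const) (use S in \<open>auto simp: I_def\<close>)
    finally show "measure_pmf.prob (balls_into_bins n k) (F S) = (1 / real n) ^ d"
      using S by (simp add: I_def)
  qed
  finally show ?thesis using I by simp
qed

lemma prob_some_load_ge:
  assumes "0 < n"
  shows "measure_pmf.prob (balls_into_bins n k) {a. \<exists>j\<in>{1..n}. d \<le> bin_load k a j}
           \<le> real n * (real (k choose d) * (1 / real n) ^ d)"
proof -
  have "{a. \<exists>j\<in>{1..n}. d \<le> bin_load k a j} = (\<Union>j\<in>{1..n}. {a. d \<le> bin_load k a j})" by blast
  also have "measure_pmf.prob (balls_into_bins n k) \<dots>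
      \<le> (\<Sum>j\<in>{1..n}. measure_pmf.prob (balls_into_bins n k) {a. d \<le> bin_load k a j})"
    by (intro measure_pmf.finite_measure_subadditive_finite) auto
  also have "\<dots> \<le> (\<Sum>j\<in>{1..n}. real (k choose d) * (1 / real n) ^ d)"
    by (intro sum_mono prob_load_ge)
  finally show ?thesis by simp
qed

text \<open>The event splits according to the exact set \<open>S\<close> of balls in bin
  \<open>j\<close>; the parts are disjoint, so their probabilities add up.\<close>

lemma prob_load_eq:
  assumes j: "j \<in> {1..n}"
  shows "measure_pmf.prob (balls_into_bins n k) {a. bin_load k a j = d}
           = real (k choose d) * (1 / real n) ^ d * (1 - 1 / real n) ^ (k - d)"
proof -
  define I where "I = {S. S \<subseteq> {1..k} \<and> card S = d}"
  define F where "F = (\<lambda>S. Pi {1..k} (\<lambda>i. if i \<in> S then {j} else if i \<in> {} then {} else - {j}))"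
  have n: "0 < n" using j by simp
  have I: "finite I" "card I = k choose d" by (simp_all add: I_def n_subsets)
  have F: "S = {i \<in> {1..k}. a i = j}" if "S \<in> I" "a \<in> F S" for S a
    using that by (auto simp: I_def F_def Pi_def split: if_splits)
  have "{a. bin_load k a j = d} = (\<Union>S\<in>I. F S)"
  proof (intro equalityI subsetI)
    fix a assume "a \<in> {a. bin_load k a j = d}"
    hence "{i \<in> {1..k}. a i = j} \<in> I" "a \<in> F {i \<in> {1..k}. a i = j}" by (auto simp: I_def F_def bin_load_def)
    thus "a \<in> (\<Union>S\<in>I. F S)" by blast
  next
    fix a assume "a \<in> (\<Union>S\<in>I. F S)"
    then obtain S where S: "S \<in> I" "a \<in> F S" by blast
    thus "a \<in> {a. bin_load k a j = d}" using F[OF S] by (simp add: I_def bin_load_def)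
  qed
  also have "measure_pmf.prob (balls_into_bins n k) \<dots>
      = (\<Sum>S\<in>I. measure_pmf.prob (balls_into_bins n k) (F S))"
  proof (rule measure_pmf.finite_measure_finite_Union)
    show "disjoint_family_on F I"
      unfolding disjoint_family_on_def using F by blast
  qed (use I(1) in auto)
  also have "\<dots> = (\<Sum>S\<in>I. (1 / real n) ^ d * (1 - 1 / real n) ^ (k - d))"
  proof (rule sum.cong[OF refl])
    fix S assume S: "S \<in> I"
    have c: "real (card ({1..n} \<inter> - {j})) / real n = 1 - 1 / real n"
    proof -
      have "{1..n} \<inter> - {j} = {1..n} - {j}" by blast
      hence "card ({1..n} \<inter> - {j}) = n - 1" using j by simp
      thus ?thesis using n by (simp add: of_nat_diff field_simps)
    qed
    have "measure_pmf.prob (balls_into_bins n k) (F S)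
        = (\<Prod>i\<in>{1..k}. if i \<in> S then 1 / real n else if i \<in> {} then 1 else 1 - 1 / real n)"
      unfolding F_def prob_balls_Pi[OF n]
      by (intro prod.cong) (use j c in auto)
    also have "\<dots> = (1 / real n) ^ card S * 1 ^ card ({}::nat set)
        * (1 - 1 / real n) ^ (card {1..k} - card S - card ({}::nat set))"
      by (rule prod_if_if_const) (use S in \<open>auto simp: I_def\<close>)
    finally show "measure_pmf.prob (balls_into_bins n k) (F S)
        = (1 / real n) ^ d * (1 - 1 / real n) ^ (k - d)"
      using S by (simp add: I_def)
  qed
  finally show ?thesis using I by (simp add: mult.assoc)
qed

text \<open>Union bound over the ordered pairs of disjoint sets of \<open>d\<close> balls that make
  up the contents of the two bins. If \<open>2 * d > k\<close>, the second binomial coefficient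
  vanishes.\<close>

lemma prob_two_loads_eq_le:
  assumes j: "j \<in> {1..n}" and l: "l \<in> {1..n}" and jl: "j \<noteq> l"
  shows "measure_pmf.prob (balls_into_bins n k) ({a. bin_load k a j = d} \<inter> {a. bin_load k a l = d})
           \<le> real (k choose d) * real ((k - d) choose d)
               * ((1 / real n) ^ (2 * d) * (1 - 2 / real n) ^ (k - 2 * d))"
proof -
  define I where "I = (SIGMA S : {S. S \<subseteq> {1..k} \<and> card S = d}. {T. T \<subseteq> {1..k} - S \<and> card T = d})"
  define F where "F = (\<lambda>(S, T). Pi {1..k} (\<lambda>i. if i \<in> S then {j} else if i \<in> T then {l} else - {j, l}))"
  have n: "0 < n" using j by simp
  have finI: "finite I" unfolding I_def by (intro finite_SigmaI) auto
  have "card I = (\<Sum>S | S \<subseteq> {1..k} \<and> card S = d. card {T. T \<subseteq> {1..k} - S \<and> card T = d})"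
    unfolding I_def by (rule card_SigmaI) auto
  also have "\<dots> = (\<Sum>S | S \<subseteq> {1..k} \<and> card S = d. (k - d) choose d)"
  proof (rule sum.cong[OF refl])
    fix S assume S: "S \<in> {S. S \<subseteq> {1..k} \<and> card S = d}"
    hence "finite S" using finite_subset[of S "{1..k}"] by auto
    thus "card {T. T \<subseteq> {1..k} - S \<and> card T = d} = (k - d) choose d"
      using S by (subst n_subsets) (auto simp: card_Diff_subset)
  qed
  finally have cI: "card I = (k choose d) * ((k - d) choose d)" by (simp add: n_subsets)
  have "{a. bin_load k a j = d} \<inter> {a. bin_load k a l = d} \<subseteq> (\<Union>p\<in>I. F p)"
  proof
    fix a assume a: "a \<in> {a. bin_load k a j = d} \<inter> {a. bin_load k a l = d}"
    hence "({i \<in> {1..k}. a i = j}, {i \<in> {1..k}. a i = l}) \<in> I"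
      "a \<in> F ({i \<in> {1..k}. a i = j}, {i \<in> {1..k}. a i = l})"
      using jl by (auto simp: I_def F_def bin_load_def)
    thus "a \<in> (\<Union>p\<in>I. F p)" by blast
  qed
  hence "measure_pmf.prob (balls_into_bins n k) ({a. bin_load k a j = d} \<inter> {a. bin_load k a l = d})
      \<le> measure_pmf.prob (balls_into_bins n k) (\<Union>p\<in>I. F p)"
    by (intro measure_pmf.finite_measure_mono) auto
  also have "\<dots> \<le> (\<Sum>p\<in>I. measure_pmf.prob (balls_into_bins n k) (F p))"
    using finI by (intro measure_pmf.finite_measure_subadditive_finite) auto
  also have "\<dots> = (\<Sum>p\<in>I. (1 / real n) ^ (2 * d) * (1 - 2 / real n) ^ (k - 2 * d))"
  proof (rule sum.cong[OF refl])
    fix p assume p: "p \<in> I"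
    obtain S T where pST: "p = (S, T)" by force
    have ST: "S \<subseteq> {1..k}" "T \<subseteq> {1..k}" "S \<inter> T = {}" "card S = d" "card T = d"
      using p by (auto simp: pST I_def)
    have c: "real (card ({1..n} \<inter> - {j, l})) / real n = 1 - 2 / real n"
    proof -
      have "{1..n} \<inter> - {j, l} = {1..n} - {j, l}" by blast
      hence "card ({1..n} \<inter> - {j, l}) = n - 2" using j l jl by (simp add: card_Diff_subset)
      moreover have "2 \<le> n" using j l jl by auto
      ultimately show ?thesis using n by (simp add: of_nat_diff field_simps)
    qed
    have "measure_pmf.prob (balls_into_bins n k) (F p)
        = (\<Prod>i\<in>{1..k}. if i \<in> S then 1 / real n else if i \<in> T then 1 / real n else 1 - 2 / real n)"
      unfolding F_def pST prod.case prob_balls_Pi[OF n]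
      by (intro prod.cong) (use j l c in auto)
    also have "\<dots> = (1 / real n) ^ card S * (1 / real n) ^ card T
        * (1 - 2 / real n) ^ (card {1..k} - card S - card T)"
      by (rule prod_if_if_const) (use ST in auto)
    finally show "measure_pmf.prob (balls_into_bins n k) (F p)
        = (1 / real n) ^ (2 * d) * (1 - 2 / real n) ^ (k - 2 * d)"
      using ST by (simp add: mult_2 power_add)
  qed
  finally show ?thesis by (simp add: cI)
qed

section \<open>Near-independence of two bins and the second moment method\<close>

text \<open>With \<open>x = 1 / n\<close>, the factors \<open>1 - 2 * x\<close> are at most the
  square of \<open>1 - x\<close>, and \<open>(k - d) choose d \<le> k choose d\<close>. What the
  joint bound then lacks compared with the square of \<open>p\<close> is the factor
  \<open>(1 - x) ^ (2 * d)\<close>, which Bernoulli bounds from below by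
  \<open>1 - 2 * d / n\<close>.\<close>

lemma load_correlation_le:
  assumes j: "j \<in> {1..n}" and l: "l \<in> {1..n}" and jl: "j \<noteq> l"
    and p: "p = real (k choose d) * (1 / real n) ^ d * (1 - 1 / real n) ^ (k - d)"
  shows "measure_pmf.prob (balls_into_bins n k) ({a. bin_load k a j = d} \<inter> {a. bin_load k a l = d})
           * (1 - 2 * real d / real n) \<le> p\<^sup>2"
    (is "?q * _ \<le> _")
proof (cases "2 * d \<le> k")
  case False
  hence "(k - d) choose d = 0" by (intro binomial_eq_0) simp
  hence "?q \<le> 0" using prob_two_loads_eq_le[OF j l jl, of k d] by (simp del: binomial_eq_0_iff)
  hence "?q = 0" using measure_nonneg by (intro antisym)
  thus ?thesis by simp
next
  case True
  have n: "2 \<le> n" using j l jl by auto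
  define x where "x = 1 / real n"
  have x: "0 < x" "x \<le> 1 / 2" using n by (auto simp: x_def field_simps)
  have "1 - 2 * real d / real n \<le> (1 - x) ^ (2 * d)"
    using Bernoulli_inequality[of "- x" "2 * d"] x by (simp add: x_def)
  hence "?q * (1 - 2 * real d / real n) \<le> ?q * (1 - x) ^ (2 * d)"
    by (intro mult_left_mono) auto
  also have "\<dots> \<le> (real (k choose d) * real ((k - d) choose d)
               * (x ^ (2 * d) * (1 - 2 * x) ^ (k - 2 * d))) * (1 - x) ^ (2 * d)"
    using prob_two_loads_eq_le[OF j l jl, of k d] x
    by (intro mult_right_mono) (auto simp: x_def)
  also have "\<dots> \<le> (real (k choose d) * real (k choose d)
               * (x ^ (2 * d) * ((1 - x)\<^sup>2) ^ (k - 2 * d))) * (1 - x) ^ (2 * d)"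
    using x
    by (intro mult_right_mono mult_mono power_mono)
       (auto simp: binomial_mono power2_eq_square algebra_simps intro!: binomial_right_mono)
  also have "\<dots> = p\<^sup>2"
  proof -
    have "2 * (k - d) = 2 * (k - 2 * d) + 2 * d" using True by simp
    hence "((1 - x) ^ (k - d))\<^sup>2 = ((1 - x)\<^sup>2) ^ (k - 2 * d) * (1 - x) ^ (2 * d)"
      by (metis mult.commute power_add power_mult)
    thus ?thesis
      by (simp add: p power_mult_distrib x_def[symmetric] power2_eq_square mult_2 power_add)
  qed
  finally show ?thesis .
qed

text \<open>Chebyshev's argument for the number \<open>X\<close> of events that occur: where none
  occurs, the squared deviation of \<open>X\<close> from its mean \<open>\<mu>\<close> equals the
  square of \<open>\<mu>\<close>, so its integral, the variance, bounds the left-hand side.\<close>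

lemma second_moment_prob_none:
  fixes M :: "'a pmf" and A :: "'i \<Rightarrow> 'a set"
  assumes J: "finite J" and \<mu>: "\<mu> = (\<Sum>j\<in>J. measure_pmf.prob M (A j))"
  shows "measure_pmf.prob M (- (\<Union>j\<in>J. A j)) * \<mu>\<^sup>2
           \<le> (\<Sum>j\<in>J. \<Sum>l\<in>J. measure_pmf.prob M (A j \<inter> A l)) - \<mu>\<^sup>2"
proof -
  define X :: "'a \<Rightarrow> real" where "X = (\<lambda>w. \<Sum>j\<in>J. indicator (A j) w)"
  \<comment> \<open>The squared deviation in expanded form, so that its integral can be computed
    term by term from the pair probabilities.\<close>
  define g :: "'a \<Rightarrow> real" where
    "g = (\<lambda>w. (\<Sum>j\<in>J. \<Sum>l\<in>J. indicator (A j \<inter> A l) w) - 2 * \<mu> * X w + \<mu>\<^sup>2)"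
  have g: "g w = (X w - \<mu>)\<^sup>2" for w
  proof -
    have "(\<Sum>j\<in>J. \<Sum>l\<in>J. indicator (A j \<inter> A l) w) = X w * X w"
      by (simp add: X_def sum_product indicator_inter_arith)
    thus ?thesis by (simp add: g_def power2_eq_square algebra_simps)
  qed
  have ind: "integrable (measure_pmf M) (indicator B :: 'a \<Rightarrow> real)" for B
    by (rule measure_pmf.integrable_const_bound[where B = 1]) auto
  have iX: "integrable (measure_pmf M) X"
    unfolding X_def by (intro Bochner_Integration.integrable_sum ind)
  have EX: "(\<integral>w. X w \<partial>measure_pmf M) = \<mu>"
    unfolding X_def by (subst Bochner_Integration.integral_sum) (auto simp: \<mu> ind)
  have iXX: "integrable (measure_pmf M) (\<lambda>w. \<Sum>j\<in>J. \<Sum>l\<in>J. indicator (A j \<inter> A l) w :: real)"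
    by (intro Bochner_Integration.integrable_sum ind)
  have ig: "integrable (measure_pmf M) g"
    unfolding g_def by (intro Bochner_Integration.integrable_add Bochner_Integration.integrable_diff
        integrable_mult_right iXX iX) auto
  have EXX: "(\<integral>w. (\<Sum>j\<in>J. \<Sum>l\<in>J. indicator (A j \<inter> A l) w :: real) \<partial>measure_pmf M)
      = (\<Sum>j\<in>J. \<Sum>l\<in>J. measure_pmf.prob M (A j \<inter> A l))"
    by (subst Bochner_Integration.integral_sum, intro Bochner_Integration.integrable_sum ind,
        rule sum.cong[OF refl], subst Bochner_Integration.integral_sum) (auto intro: ind)
  have Eg: "(\<integral>w. g w \<partial>measure_pmf M)
      = (\<Sum>j\<in>J. \<Sum>l\<in>J. measure_pmf.prob M (A j \<inter> A l)) - 2 * \<mu> * \<mu> + \<mu>\<^sup>2"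
    unfolding g_def
    by (subst Bochner_Integration.integral_add, (intro Bochner_Integration.integrable_diff
        integrable_mult_right iXX iX)[1], simp,
        subst Bochner_Integration.integral_diff[OF iXX integrable_mult_right[OF iX]])
       (simp add: EXX EX)
  have "measure_pmf.prob M (- (\<Union>j\<in>J. A j)) * \<mu>\<^sup>2
      = (\<integral>w. indicator (- (\<Union>j\<in>J. A j)) w * \<mu>\<^sup>2 \<partial>measure_pmf M)"
    by simp
  also have "\<dots> \<le> (\<integral>w. g w \<partial>measure_pmf M)"
  proof (rule integral_mono)
    show "integrable (measure_pmf M) (\<lambda>w. indicator (- (\<Union>j\<in>J. A j)) w * \<mu>\<^sup>2)"
      by (intro integrable_mult_left ind)
    show "indicator (- (\<Union>j\<in>J. A j)) w * \<mu>\<^sup>2 \<le> g w" for w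
    proof (cases "w \<in> - (\<Union>j\<in>J. A j)")
      case True
      hence "X w = 0" by (auto simp: X_def intro!: sum.neutral)
      thus ?thesis using True by (simp add: g)
    qed (simp add: g)
  qed (rule ig)
  also have "\<dots> = (\<Sum>j\<in>J. \<Sum>l\<in>J. measure_pmf.prob M (A j \<inter> A l)) - \<mu>\<^sup>2"
    by (simp add: Eg power2_eq_square)
  finally show ?thesis .
qed

lemma prob_no_load_eq:
  assumes n: "2 \<le> n" "4 * d \<le> n"
    and p: "p = real (k choose d) * (1 / real n) ^ d * (1 - 1 / real n) ^ (k - d)"
    and pos: "0 < p"
  shows "measure_pmf.prob (balls_into_bins n k) {a. \<forall>j\<in>{1..n}. bin_load k a j \<noteq> d}
           \<le> 1 / (real n * p) + 4 * real d / real n"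
proof -
  let ?P = "measure_pmf.prob (balls_into_bins n k)"
  define A where "A = (\<lambda>j. {a. bin_load k a j = d})"
  define \<mu> where "\<mu> = real n * p"
  \<comment> \<open>Twice the deficit \<open>2 * d / n\<close> of
    \<open>load_correlation_le\<close>: for \<open>0 \<le> t \<le> 1\<close>, which
    \<open>4 * d \<le> n\<close> ensures, \<open>(1 - t / 2) * (1 + t) \<ge> 1\<close> moves the
    factor to the other side.\<close>
  define t where "t = 4 * real d / real n"
  have \<mu>: "0 < \<mu>" using n pos by (simp add: \<mu>_def)
  have PA: "?P (A j) = p" if "j \<in> {1..n}" for j
    using prob_load_eq[OF that] by (simp add: A_def p)
  have q: "?P (A j \<inter> A l) \<le> p\<^sup>2 * (1 + t)" if jl: "j \<in> {1..n}" "l \<in> {1..n}" "j \<noteq> l" for j l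
  proof -
    have t: "0 \<le> t" "t \<le> 1" using n by (auto simp: t_def field_simps)
    have *: "?P (A j \<inter> A l) * (1 - t / 2) \<le> p\<^sup>2"
      using load_correlation_le[OF jl p] by (simp add: A_def t_def)
    have "1 \<le> (1 - t / 2) * (1 + t)"
    proof -
      have "0 \<le> t * (1 - t)" using t by simp
      thus ?thesis by (simp add: algebra_simps)
    qed
    hence "?P (A j \<inter> A l) * 1 \<le> ?P (A j \<inter> A l) * ((1 - t / 2) * (1 + t))"
      by (intro mult_left_mono) auto
    also have "\<dots> \<le> p\<^sup>2 * (1 + t)"
      using mult_right_mono[OF *, of "1 + t"] t by (simp add: mult.assoc)
    finally show ?thesis by simp
  qed
  have "?P (- (\<Union>j\<in>{1..n}. A j)) * \<mu>\<^sup>2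
      \<le> (\<Sum>j\<in>{1..n}. \<Sum>l\<in>{1..n}. ?P (A j \<inter> A l)) - \<mu>\<^sup>2"
    by (rule second_moment_prob_none) (auto simp: PA \<mu>_def)
  \<comment> \<open>The off-diagonal bound is nonnegative and may be added on the diagonal too; the
    diagonal probabilities themselves sum to \<open>\<mu>\<close>.\<close>
  also have "(\<Sum>j\<in>{1..n}. \<Sum>l\<in>{1..n}. ?P (A j \<inter> A l))
      \<le> (\<Sum>j\<in>{1..n}. \<Sum>l\<in>{1..n}. p\<^sup>2 * (1 + t) + (if l = j then p else 0))"
  proof (intro sum_mono)
    fix j l assume jl: "j \<in> {1..n}" "l \<in> {1..n}"
    have "0 \<le> p\<^sup>2 * (1 + t)" by (simp add: t_def)
    thus "?P (A j \<inter> A l) \<le> p\<^sup>2 * (1 + t) + (if l = j then p else 0)"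
      using q[OF jl] PA[OF jl(1)] by auto
  qed
  also have "\<dots> = \<mu>\<^sup>2 * (1 + t) + \<mu>"
    by (simp add: sum.distrib \<mu>_def power2_eq_square algebra_simps)
  finally have "?P (- (\<Union>j\<in>{1..n}. A j)) * \<mu>\<^sup>2 \<le> \<mu>\<^sup>2 * t + \<mu>" by (simp add: algebra_simps)
  hence "?P (- (\<Union>j\<in>{1..n}. A j)) \<le> (\<mu>\<^sup>2 * t + \<mu>) / \<mu>\<^sup>2"
    using \<mu> by (simp add: pos_le_divide_eq)
  also have "\<dots> = 1 / \<mu> + t" using \<mu> by (simp add: field_simps power2_eq_square)
  also have "- (\<Union>j\<in>{1..n}. A j) = {a. \<forall>j\<in>{1..n}. bin_load k a j \<noteq> d}" by (auto simp: A_def)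
  finally show ?thesis by (simp add: \<mu>_def t_def)
qed

section \<open>The zero of the exponent\<close>

text \<open>Stirling's formula with explicit error. The expression is 1 at \<open>d = 1\<close> and
  does not increase. The trapezoidal bound for \<open>ln (d + 1) - ln d\<close> limits each decrease
  to \<open>1 / (4 * d) - 1 / (4 * (d + 1))\<close>, and the term \<open>1 / (4 * d)\<close> in the
  lower bound makes these differences telescope.\<close>

lemma ln_fact_bounds:
  assumes "1 \<le> d"
  shows "ln (fact d) - (real d + 1/2) * ln (real d) + real d \<in> {3/4 + 1 / (4 * real d)..1}"
  using assms
proof (induction d rule: dec_induct)
  case base
  show ?case by simp
next
  case (step d)
  have d: "0 < real d" using step by simp
  define L where "L = ln (real d + 1) - ln (real d)"
  have "2 / (2 * real d + 1) \<le> L"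
    using ln_inverse_approx_ge[of "real d" "real d + 1"] d by (simp add: L_def)
  hence lo: "1 \<le> (real d + 1/2) * L" using d by (simp add: field_simps)
  have "L \<le> (inverse (real d) + inverse (real d + 1)) / 2"
    using ln_inverse_approx_le[of "real d" 1] d by (simp add: L_def)
  hence "(real d + 1/2) * L \<le> (real d + 1/2) * ((inverse (real d) + inverse (real d + 1)) / 2)"
    using d by (intro mult_left_mono) auto
  also have "\<dots> = 1 + (1 / (4 * real d) - 1 / (4 * (real d + 1)))"
    using d by (simp add: divide_simps) (simp add: algebra_simps)
  finally have hi: "(real d + 1/2) * L \<le> 1 + (1 / (4 * real d) - 1 / (4 * (real d + 1)))" .
  have "ln (fact (Suc d) :: real) = ln (real d + 1) + ln (fact d)"
    by (simp add: ln_mult add.commute)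
  hence "ln (fact (Suc d)) - (real (Suc d) + 1/2) * ln (real (Suc d)) + real (Suc d)
      = (ln (fact d) - (real d + 1/2) * ln (real d) + real d) + (1 - (real d + 1/2) * L)"
    by (simp add: L_def algebra_simps)
  thus ?case using step.IH lo hi by (simp add: add.commute)
qed

text \<open>\<open>nu_fun n k d\<close> is the logarithm of \<open>n * (k / n) ^ d / d!\<close> with
  Stirling's approximation for the factorial. The error lies between 0 and 1, hence the factor
  \<open>exp 1\<close>.\<close>

lemma exp_nu_fun_bounds:
  assumes "0 < n" "0 < k" "0 < d"
  shows "real n * (real k / real n) ^ d / fact d \<le> exp (nu_fun n k (real d))"
    and "exp (nu_fun n k (real d)) \<le> exp 1 * (real n * (real k / real n) ^ d / fact d)"
proof -
  define y where "y = real n * (real k / real n) ^ d / fact d"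
  have y: "0 < y" using assms by (simp add: y_def)
  have "ln y = ln (real n) + real d * (ln (real k) - ln (real n)) - ln (fact d)"
    using assms by (simp add: y_def ln_div ln_mult ln_realpow)
  hence "nu_fun n k (real d)
      = ln y + (ln (fact d) - (real d + 1/2) * ln (real d) + real d)"
    by (simp add: nu_fun_def algebra_simps)
  moreover have "0 \<le> 1 / (4 * real d)" by simp
  ultimately have "ln y \<le> nu_fun n k (real d)" "nu_fun n k (real d) \<le> 1 + ln y"
    using ln_fact_bounds[of d] assms(3) unfolding atLeastAtMost_iff by linarith+
  hence "exp (ln y) \<le> exp (nu_fun n k (real d))" "exp (nu_fun n k (real d)) \<le> exp 1 * exp (ln y)"
    by (simp_all flip: exp_add)
  thus "real n * (real k / real n) ^ d / fact d \<le> exp (nu_fun n k (real d))"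
    "exp (nu_fun n k (real d)) \<le> exp 1 * (real n * (real k / real n) ^ d / fact d)"
    unfolding y_def[symmetric] by (simp_all only: exp_ln[OF y])
qed

section \<open>Location of the zero and growth of the exponent around it\<close>

lemma nu_zero:
  assumes "0 < n" "0 < k"
  shows "1 < nu n k" "nu_fun n k (nu n k) = 0"
proof -
  have *: "0 < nu n k" "nu_fun n k (nu n k) = 0"
    using theI'[OF nu_fun_unique_zero[OF assms]] by (simp_all add: nu_def)
  show "nu_fun n k (nu n k) = 0" by fact
  show "1 < nu n k"
  proof (rule ccontr)
    define x where "x = nu n k"
    assume "\<not> 1 < nu n k"
    hence x: "0 < x" "x \<le> 1" using * by (simp_all add: x_def)
    \<comment> \<open>Grouped so that for \<open>0 < x \<le> 1\<close> no term is negative while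
      \<open>x\<close> itself is positive; thus there is no zero up to 1.\<close>
    have "nu_fun n k x = x * ln (real k) + x - (x + 1/2) * ln x + (1 - x) * ln (real n)"
      by (simp add: nu_fun_def algebra_simps)
    moreover have "0 \<le> x * ln (real k)" using x assms by simp
    moreover have "(x + 1/2) * ln x \<le> 0" using x by (intro mult_nonneg_nonpos) auto
    moreover have "0 \<le> (1 - x) * ln (real n)" using x assms by simp
    ultimately show False using x * by (simp add: x_def)
  qed
qed

lemma nu_fun_concave:
  assumes "0 < n" "0 < k"
  shows "concave_on {1..} (nu_fun n k)"
proof (rule f''_le0_imp_concave)
  fix x :: real assume x: "x \<in> {1..}"
  show "(nu_fun n k has_real_derivative (ln (real k) - ln (real n) - ln x - 1 / (2 * x))) (at x)"
    using x assms by (intro nu_fun_deriv) auto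
  show "((\<lambda>x. ln (real k) - ln (real n) - ln x - 1 / (2 * x)) has_real_derivative
      (- 1 / x + 1 / (2 * x\<^sup>2))) (at x)"
    using x by (auto intro!: derivative_eq_intros simp: field_simps power2_eq_square)
  show "- 1 / x + 1 / (2 * x\<^sup>2) \<le> 0"
    using x by (simp add: field_simps power2_eq_square)
qed (rule convex_real_interval)

text \<open>Concavity with denominators cleared. In use, one of the points is \<open>nu n k\<close>,
  whose term drops out.\<close>

lemma nu_fun_chord:
  assumes "0 < n" "0 < k" and "1 \<le> a" "a \<le> b" "b \<le> c" "a < c"
  shows "(c - b) * nu_fun n k a + (b - a) * nu_fun n k c \<le> (c - a) * nu_fun n k b"
proof -
  define t where "t = (b - a) / (c - a)"
  have t: "0 \<le> t" "t \<le> 1" "1 - t = (c - b) / (c - a)"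
    using assms by (simp_all add: t_def field_simps)
  have b: "(1 - t) *\<^sub>R a + t *\<^sub>R c = b"
  proof -
    have "(1 - t) * a + t * c = a + t * (c - a)" by (simp add: algebra_simps)
    also have "\<dots> = b" using assms by (simp add: t_def)
    finally show ?thesis by simp
  qed
  have "(1 - t) * nu_fun n k a + t * nu_fun n k c \<le> nu_fun n k b"
    using concave_onD[OF nu_fun_concave[OF assms(1,2)] t(1,2), of a c] assms b by simp
  hence "(c - a) * ((1 - t) * nu_fun n k a + t * nu_fun n k c) \<le> (c - a) * nu_fun n k b"
    using assms by (intro mult_left_mono) auto
  moreover have "(c - a) * ((1 - t) * nu_fun n k a + t * nu_fun n k c)
      = (c - b) * nu_fun n k a + (b - a) * nu_fun n k c"
  proof -
    have "(c - a) * (1 - t) = c - b" "(c - a) * t = b - a"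
      unfolding t(3) using assms by (simp_all add: t_def)
    thus ?thesis by (metis distrib_left mult.assoc)
  qed
  ultimately show ?thesis by simp
qed

lemma nu_fun_1: "nu_fun n k 1 = 1 + ln (real k)"
  by (simp add: nu_fun_def)

text \<open>Between 1 and its zero the concave function lies above the chord joining
  \<open>(1, 1 + ln k)\<close> to the zero.\<close>

lemma nu_fun_below_nu:
  assumes "0 < n" "0 < k" "0 < \<epsilon>" "1 \<le> x" "x \<le> nu n k - \<epsilon>"
  shows "\<epsilon> * (1 + ln (real k)) / (nu n k - 1) \<le> nu_fun n k x"
proof -
  have "\<epsilon> * (1 + ln (real k)) \<le> (nu n k - x) * (1 + ln (real k))"
    using assms by (intro mult_right_mono) auto
  also have "\<dots> \<le> (nu n k - 1) * nu_fun n k x"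
    using nu_fun_chord[OF assms(1,2), of 1 x "nu n k"] nu_zero[OF assms(1,2)] assms
    by (simp add: nu_fun_1)
  finally show ?thesis using nu_zero[OF assms(1,2)] by (simp add: field_simps)
qed

text \<open>Beyond the zero the concave function lies below the extension of the same chord.\<close>

lemma nu_fun_above_nu:
  assumes "0 < n" "0 < k" "0 < \<epsilon>" "nu n k + \<epsilon> \<le> x"
  shows "nu_fun n k x \<le> - (\<epsilon> * (1 + ln (real k)) / (nu n k - 1))"
proof -
  have "\<epsilon> * (1 + ln (real k)) \<le> (x - nu n k) * (1 + ln (real k))"
    using assms by (intro mult_right_mono) auto
  also have "\<dots> \<le> - ((nu n k - 1) * nu_fun n k x)"
    using nu_fun_chord[OF assms(1,2), of 1 "nu n k" x] nu_zero[OF assms(1,2)] assms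
    by (simp add: nu_fun_1)
  finally show ?thesis using nu_zero[OF assms(1,2)] by (simp add: field_simps)
qed

text \<open>At the zero \<open>x\<close>, the equation and \<open>k \<le> C * n\<close> give
  \<open>x * (ln x - 1 - ln C) \<le> ln n\<close>. The bracket is at least \<open>A\<close> once
  \<open>x\<close> exceeds \<open>B\<close>; smaller \<open>x\<close> are covered by
  \<open>A * B \<le> ln n\<close>. The bound is uniform in \<open>k\<close>, which varies with
  \<open>n\<close> later.\<close>

lemma nu_le_small_ln:
  assumes "0 < A" "0 < C"
  shows "\<forall>\<^sub>F n in sequentially. \<forall>k. 0 < k \<longrightarrow> real k \<le> C * real n \<longrightarrow> A * nu n k \<le> ln (real n)"
proof -
  define B where "B = exp (A + 1 + ln C)"
  have "\<forall>\<^sub>F n in sequentially. A * B \<le> ln (real n)" by real_asymp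
  thus ?thesis
    using eventually_gt_at_top[of 0]
  proof eventually_elim
    case (elim n)
    show ?case
    proof (intro allI impI)
      fix k assume k: "0 < k" "real k \<le> C * real n"
      define x where "x = nu n k"
      have x: "1 < x" "nu_fun n k x = 0" using nu_zero[OF elim(2) k(1)] by (simp_all add: x_def)
      show "A * nu n k \<le> ln (real n)"
      proof (cases "x \<le> B")
        case True
        hence "A * x \<le> A * B" using assms by (intro mult_left_mono) auto
        thus ?thesis using elim by (simp add: x_def)
      next
        case False
        have "ln (real k) \<le> ln (C * real n)" using k assms elim by (subst ln_le_cancel_iff) auto
        also have "\<dots> = ln C + ln (real n)" using assms elim by (simp add: ln_mult)
        finally have "x * (ln (real k) - ln (real n)) \<le> x * ln C"
          using x by (intro mult_left_mono) auto
        moreover have "(x + 1/2) * ln x = x * (ln (real k) - ln (real n)) + x + ln (real n)"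
          using x(2) by (simp add: nu_fun_def algebra_simps)
        moreover have "A + 1 + ln C \<le> ln x"
          using False x by (simp add: B_def ln_ge_iff)
        hence "x * (A + 1 + ln C) \<le> x * ln x" using x by (intro mult_left_mono) auto
        moreover have "0 \<le> ln x" using x by simp
        ultimately show ?thesis by (simp add: x_def[symmetric] algebra_simps)
      qed
    qed
  qed
qed

section \<open>The maximum load\<close>

lemma prob_some_load_ge_exp:
  assumes "0 < n" "0 < k" "0 < d"
  shows "measure_pmf.prob (balls_into_bins n k) {a. \<exists>j\<in>{1..n}. d \<le> bin_load k a j}
           \<le> exp (nu_fun n k (real d))"
proof -
  have "real (k choose d) * fact d \<le> real k ^ d"
    using binomial_fact_pow[of k d] by (metis of_nat_fact of_nat_le_iff of_nat_mult of_nat_power)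
  hence "real (k choose d) \<le> real k ^ d / fact d" by (simp add: field_simps)
  hence "real n * (real (k choose d) * (1 / real n) ^ d)
      \<le> real n * (real k ^ d / fact d * (1 / real n) ^ d)"
    by (intro mult_left_mono mult_right_mono) auto
  also have "\<dots> = real n * (real k / real n) ^ d / fact d" by (simp add: power_divide)
  also note exp_nu_fun_bounds(1)[OF assms]
  finally show ?thesis using prob_some_load_ge[OF assms(1), of k d] by linarith
qed

text \<open>First moment method. For \<open>n < k ^ 4\<close> the exponent at \<open>d\<close> is at
  most \<open>ln \<eta>\<close>; for smaller \<open>k\<close> a collision of two balls is already
  unlikely.\<close>

lemma eventually_max_load_le:
  assumes "0 < \<epsilon>" "0 < \<eta>" "0 < C"
  shows "\<forall>\<^sub>F n in sequentially. \<forall>k d. real k \<le> C * real n \<longrightarrow> nu n k + \<epsilon> \<le> real d \<longrightarrow>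
    measure_pmf.prob (balls_into_bins n k) {a. \<exists>j\<in>{1..n}. d \<le> bin_load k a j} \<le> \<eta>"
proof -
  \<comment> \<open>If \<open>A * nu n k \<le> ln n \<le> 4 * (1 + ln k)\<close>, the exponent is at
    most \<open>- \<epsilon> * A / 4\<close>, which must not exceed \<open>ln \<eta>\<close>. The
    maximum keeps \<open>A\<close> positive when \<open>\<eta> \<ge> 1\<close>.\<close>
  define A where "A = max 1 (4 / \<epsilon> * (- ln \<eta>))"
  have A: "0 < A" "- ln \<eta> \<le> \<epsilon> * A / 4"
  proof -
    show "0 < A" by (simp add: A_def)
    have "\<epsilon> * (4 / \<epsilon> * (- ln \<eta>)) \<le> \<epsilon> * A"
      unfolding A_def using assms by (intro mult_left_mono) auto
    thus "- ln \<eta> \<le> \<epsilon> * A / 4" using assms by simp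
  qed
  have "\<forall>\<^sub>F n in sequentially. 1 / sqrt (real n) \<le> \<eta>" using assms by real_asymp
  thus ?thesis
    using eventually_gt_at_top[of 0] nu_le_small_ln[OF A(1) assms(3)]
  proof eventually_elim
    case (elim n)
    show ?case
    proof (intro allI impI)
      fix k d assume k: "real k \<le> C * real n" and d: "nu n k + \<epsilon> \<le> real d"
      let ?P = "measure_pmf.prob (balls_into_bins n k)"
      have "nu n k = nu n (max 1 k)"
        by (cases "k = 0") (auto simp: nu_def nu_fun_def max_def)
      hence "1 < nu n k" using nu_zero(1)[OF elim(2), of "max 1 k"] by simp
      hence d2: "2 \<le> d" using d assms(1) by linarith
      \<comment> \<open>If \<open>k ^ 4 \<le> n\<close>, a bin with two balls has probability at
        most \<open>1 / sqrt n\<close>; otherwise \<open>ln k\<close> is at least a quarter of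
        \<open>ln n\<close>.\<close>
      consider "k = 0" | "0 < k" "k ^ 4 \<le> n" | "0 < k" "n < k ^ 4" by linarith
      thus "?P {a. \<exists>j\<in>{1..n}. d \<le> bin_load k a j} \<le> \<eta>"
      proof cases
        case 1
        hence "{a. \<exists>j\<in>{1..n}. d \<le> bin_load k a j} = {}" using d2 by (simp add: bin_load_def)
        thus ?thesis using assms by simp
      next
        case 2
        have "?P {a. \<exists>j\<in>{1..n}. d \<le> bin_load k a j} \<le> ?P {a. \<exists>j\<in>{1..n}. 2 \<le> bin_load k a j}"
        proof (rule measure_pmf.finite_measure_mono)
          show "{a. \<exists>j\<in>{1..n}. d \<le> bin_load k a j} \<subseteq> {a. \<exists>j\<in>{1..n}. 2 \<le> bin_load k a j}"
            using le_trans[OF d2] by blast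
        qed simp
        also have "\<dots> \<le> real n * (real (k choose 2) * (1 / real n) ^ 2)"
          by (rule prob_some_load_ge[OF elim(2)])
        also have "\<dots> = real (k choose 2) / real n"
          using elim by (simp add: power2_eq_square)
        also have "\<dots> \<le> (real k)\<^sup>2 / real n"
        proof -
          have "k choose 2 \<le> k\<^sup>2" by (simp add: choose_two power2_eq_square)
             (meson div_le_dividend le_trans diff_le_self mult_le_mono2)
          hence "real (k choose 2) \<le> (real k)\<^sup>2" by (metis of_nat_le_iff of_nat_power)
          thus ?thesis by (intro divide_right_mono) auto
        qed
        also have "\<dots> \<le> sqrt (real n) / real n"
        proof -
          have "((real k)\<^sup>2)\<^sup>2 \<le> real n"
            using 2(2) by (metis of_nat_le_iff of_nat_power power_mult numeral_Bit0 mult_2 power_add power2_eq_square)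
          hence "(real k)\<^sup>2 \<le> sqrt (real n)" by (rule real_le_rsqrt)
          thus ?thesis by (intro divide_right_mono) auto
        qed
        also have "\<dots> = 1 / sqrt (real n)" by (simp add: sqrt_divide_self_eq inverse_eq_divide)
        finally show ?thesis using elim by linarith
      next
        case 3
        have nu: "1 < nu n k" by fact
        have "ln (real n) \<le> ln (real k ^ 4)"
          using 3 elim by (subst ln_le_cancel_iff) (auto simp flip: of_nat_power)
        hence "ln (real n) \<le> 4 * (1 + ln (real k))" using 3 by (simp add: ln_realpow)
        moreover have "A * nu n k \<le> ln (real n)" using elim(3) 3 k by blast
        ultimately have "A * (nu n k - 1) \<le> 4 * (1 + ln (real k))"
          using A by (simp add: algebra_simps)
        hence "A / 4 \<le> (1 + ln (real k)) / (nu n k - 1)" using nu by (simp add: field_simps)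
        hence "\<epsilon> * (A / 4) \<le> \<epsilon> * ((1 + ln (real k)) / (nu n k - 1))"
          using assms by (intro mult_left_mono) auto
        hence "nu_fun n k (real d) \<le> ln \<eta>"
          using nu_fun_above_nu[OF elim(2) 3(1) assms(1) d] A by simp
        hence "exp (nu_fun n k (real d)) \<le> \<eta>" using assms by (simp add: ln_ge_iff)
        thus ?thesis using prob_some_load_ge_exp[OF elim(2) 3(1), of d] d2 by linarith
      qed
    qed
  qed
qed

text \<open>Since \<open>2 * d\<^sup>2 \<le> k\<close>, Bernoulli shows that
  \<open>k choose d\<close> is at least half of \<open>k ^ d / d!\<close>. The probability that the
  other balls avoid the bin costs at most \<open>exp (- 2 * C)\<close>, and Stirling costs
  \<open>exp 1\<close>.\<close>

lemma expected_exact_loads_ge: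
  assumes n: "2 \<le> n" and k: "0 < k" "real k \<le> C * real n" and d: "0 < d" "2 * d\<^sup>2 \<le> k"
    and p: "p = real (k choose d) * (1 / real n) ^ d * (1 - 1 / real n) ^ (k - d)"
  shows "exp (- 2 * C) / (2 * exp 1) * exp (nu_fun n k (real d)) \<le> real n * p"
proof -
  have dk: "d \<le> k"
  proof -
    have "d * 1 \<le> d * d" using d by (intro mult_le_mono2) simp
    hence "d \<le> d\<^sup>2" by (simp only: power2_eq_square mult_1_right)
    thus ?thesis using d(2) by linarith
  qed
  have "real (2 * d\<^sup>2) \<le> real k" using d(2) by (simp only: of_nat_le_iff)
  hence dd: "real d * (real d / real k) \<le> 1/2" using k by (simp add: field_simps power2_eq_square)
  have "1/2 \<le> 1 + real d * (- (real d / real k))" using dd by simp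
  also have "\<dots> \<le> (1 - real d / real k) ^ d"
    using Bernoulli_inequality[of "- (real d / real k)" d] dk k by simp
  finally have "real k ^ d * (1/2) \<le> real k ^ d * (1 - real d / real k) ^ d"
    by (intro mult_left_mono) auto
  also have "\<dots> = (real k - real d) ^ d"
    using k by (simp add: right_diff_distrib flip: power_mult_distrib)
  also have "\<dots> \<le> real (k choose d) * fact d" by (rule power_le_choose_fact[OF order.refl dk])
  finally have ch: "real k ^ d / (2 * fact d) \<le> real (k choose d)" by (simp add: field_simps)
  have x: "0 \<le> 1 / real n" "1 / real n \<le> 1/2" using n by (auto simp: field_simps)
  have "exp (- 2 * C) \<le> exp (real k * (- 2 * (1 / real n)))"
    using k n by (simp add: field_simps)
  also have "\<dots> = exp (- 2 * (1 / real n)) ^ k" by (rule exp_of_nat_mult)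
  also have "\<dots> \<le> (1 - 1 / real n) ^ k"
    using exp_minus_double_le[OF x] by (intro power_mono) auto
  also have "\<dots> \<le> (1 - 1 / real n) ^ (k - d)" using x by (intro power_decreasing) auto
  finally have ex: "exp (- 2 * C) \<le> (1 - 1 / real n) ^ (k - d)" .
  define y where "y = real n * (real k / real n) ^ d / fact d"
  have "exp (nu_fun n k (real d)) \<le> exp 1 * y"
    unfolding y_def using exp_nu_fun_bounds(2) n k d by simp
  hence "exp (- 2 * C) / (2 * exp 1) * exp (nu_fun n k (real d))
      \<le> exp (- 2 * C) / (2 * exp 1) * (exp 1 * y)"
    by (intro mult_left_mono) auto
  also have "\<dots> = real n * (real k ^ d / (2 * fact d) * (1 / real n) ^ d * exp (- 2 * C))"
    by (simp add: y_def power_divide mult_ac)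
  also have "\<dots> \<le> real n * p"
    unfolding p using ch ex by (intro mult_left_mono mult_mono) auto
  finally show ?thesis .
qed

text \<open>Ball 1 makes its bin nonempty. This settles the threshold \<open>d = 1\<close>, where
  \<open>k\<close> may be too small for the second moment bound.\<close>

lemma prob_all_loads_0:
  assumes "0 < n" "0 < k"
  shows "measure_pmf.prob (balls_into_bins n k) {a. \<forall>j\<in>{1..n}. bin_load k a j = 0} = 0"
proof -
  have "a \<notin> {a. \<forall>j\<in>{1..n}. bin_load k a j = 0}" if "a \<in> throws n k" for a
  proof -
    have "1 \<in> {i \<in> {1..k}. a i = a 1}" using assms by simp
    moreover have "finite {i \<in> {1..k}. a i = a 1}" by simp
    ultimately have "bin_load k a (a 1) \<noteq> 0" unfolding bin_load_def card_eq_0_iff by blast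
    moreover have "a 1 \<in> (if 1 \<in> {1..k} then {1..n} else {0})"
      using that unfolding throws_iff by blast
    hence "a 1 \<in> {1..n}" using assms by simp
    ultimately show ?thesis by (auto intro!: bexI[of _ "a 1"])
  qed
  thus ?thesis
    unfolding measure_pmf_zero_iff balls_into_bins_uniform[OF assms(1)]
      set_pmf_of_set[OF throws_nonempty[OF assms(1)] finite_throws] by blast
qed

text \<open>Second moment method: for \<open>d \<ge> 2\<close> the expected number of bins with load
  exactly \<open>d\<close> is at least \<open>2 / \<eta>\<close>, and a bin with load
  \<open>d\<close> is likely to exist.\<close>

lemma eventually_max_load_ge:
  assumes "0 < \<epsilon>" "0 < \<eta>" "0 < C"
  shows "\<forall>\<^sub>F n in sequentially. \<forall>k d. real k \<le> C * real n \<longrightarrow> real d \<le> nu n k - \<epsilon> \<longrightarrow>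
    measure_pmf.prob (balls_into_bins n k) {a. \<forall>j\<in>{1..n}. bin_load k a j < d} \<le> \<eta>"
proof -
  define c where "c = exp (- 2 * C) / (2 * exp 1)"
  have c: "0 < c" by (simp add: c_def)
  \<comment> \<open>The exponent will be at least \<open>\<epsilon> * A / 2\<close>, which makes the
    expected number at least \<open>2 / \<eta>\<close>; \<open>A \<ge> 1\<close> also yields
    \<open>d \<le> nu n k \<le> ln n\<close>.\<close>
  define A where "A = max 1 (2 / \<epsilon> * ln (2 / (c * \<eta>)))"
  have A: "1 \<le> A" "ln (2 / (c * \<eta>)) \<le> \<epsilon> * A / 2"
  proof -
    show "1 \<le> A" by (simp add: A_def)
    have "\<epsilon> * (2 / \<epsilon> * ln (2 / (c * \<eta>))) \<le> \<epsilon> * A"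
      unfolding A_def using assms by (intro mult_left_mono) auto
    thus "ln (2 / (c * \<eta>)) \<le> \<epsilon> * A / 2" using assms by simp
  qed
  \<comment> \<open>\<open>ev1\<close> excludes positive \<open>d\<close> for \<open>k = 0\<close>,
    \<open>ev2\<close> bounds the correlation error, \<open>ev3\<close> gives
    \<open>4 * d \<le> n\<close> and \<open>ev4\<close> gives
    \<open>2 * d\<^sup>2 \<le> k\<close>.\<close>
  have ev1: "\<forall>\<^sub>F n in sequentially. 1 + \<epsilon> < \<epsilon> * ln (real n)" using assms by real_asymp
  have ev2: "\<forall>\<^sub>F n in sequentially. 4 * ln (real n) / real n \<le> \<eta> / 2" using assms by real_asymp
  have ev3: "\<forall>\<^sub>F n in sequentially. 4 * ln (real n) \<le> real n" by real_asymp
  have ev4: "\<forall>\<^sub>F n in sequentially. 2 * (ln (real n))\<^sup>2 \<le> exp (- 1 + ln (real n) / 2)"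
    by real_asymp
  have A0: "0 < A" using A by linarith
  show ?thesis
    using ev1 ev2 ev3 ev4 eventually_ge_at_top[of 2] nu_le_small_ln[OF A0 assms(3)]
  proof eventually_elim
    case (elim n)
    have n: "0 < n" using elim by simp
    show ?case
    proof (intro allI impI)
      fix k d assume k: "real k \<le> C * real n" and d: "real d \<le> nu n k - \<epsilon>"
      let ?P = "measure_pmf.prob (balls_into_bins n k)"
      consider "d = 0" | "0 < d" "k = 0" | "d = 1" "0 < k" | "2 \<le> d" "0 < k" by linarith
      thus "?P {a. \<forall>j\<in>{1..n}. bin_load k a j < d} \<le> \<eta>"
      proof cases
        case 1
        have *: "{a. \<forall>j\<in>{1..n}. bin_load k a j < d} = {}" using 1 n by auto
        show ?thesis unfolding * using assms by simp
      next
        case 2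
        \<comment> \<open>A positive \<open>d\<close> would force
          \<open>nu n 1 \<ge> 1 + \<epsilon>\<close>, hence a nonnegative exponent at
          \<open>1 + \<epsilon>\<close>, which \<open>ev1\<close> refutes.\<close>
        have "nu n k = nu n 1" using 2 by (simp add: nu_def nu_fun_def)
        hence "1 + \<epsilon> \<le> nu n 1" using d 2 by simp
        moreover have "0 < nu n 1 - 1" using nu_zero(1)[OF n, of 1] by simp
        ultimately have "0 \<le> nu_fun n 1 (1 + \<epsilon>)"
          using nu_fun_chord[OF n, of 1 1 "1 + \<epsilon>" "nu n 1"] nu_zero[OF n, of 1] assms
          by (simp add: nu_fun_1 zero_le_mult_iff)
             (smt (verit) zero_le_mult_iff)
        moreover have "0 \<le> (1 + \<epsilon> + 1/2) * ln (1 + \<epsilon>)" using assms by simp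
        ultimately have "\<epsilon> * ln (real n) \<le> 1 + \<epsilon>" by (simp add: nu_fun_def)
        thus ?thesis using elim by linarith
      next
        case 3
        thus ?thesis using prob_all_loads_0[OF n 3(2)] assms by simp
      next
        case 4
        define p where "p = real (k choose d) * (1 / real n) ^ d * (1 - 1 / real n) ^ (k - d)"
        have nu: "1 < nu n k" using nu_zero[OF n 4(2)] by blast
        have Anu: "A * nu n k \<le> ln (real n)" using elim 4 k by blast
        have "1 * nu n k \<le> A * nu n k" using A nu by (intro mult_right_mono) auto
        hence dln: "real d \<le> ln (real n)" using Anu d assms by linarith
        \<comment> \<open>As 2 lies in the range below \<open>nu n k - \<epsilon>\<close>, the
          exponent is nonnegative at 2; this forces \<open>ln k\<close> to be at least about half of
          \<open>ln n\<close>.\<close>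
        have "0 \<le> \<epsilon> * (1 + ln (real k)) / (nu n k - 1)" using nu assms 4 by simp
        also have "\<dots> \<le> nu_fun n k 2"
          using 4 d by (intro nu_fun_below_nu n assms) auto
        finally have "ln (real n) \<le> 2 * (1 + ln (real k)) - 5/2 * ln 2"
          by (simp add: nu_fun_def)
        moreover have "0 \<le> ln (2::real)" by simp
        ultimately have lnk: "ln (real n) \<le> 2 * (1 + ln (real k))" by linarith
        have "A * (nu n k - 1) \<le> 2 * (1 + ln (real k))"
          using lnk Anu A by (simp add: algebra_simps)
        hence "A / 2 \<le> (1 + ln (real k)) / (nu n k - 1)" using nu by (simp add: field_simps)
        hence "\<epsilon> * (A / 2) \<le> \<epsilon> * ((1 + ln (real k)) / (nu n k - 1))"
          using assms by (intro mult_left_mono) auto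
        also have "\<dots> \<le> nu_fun n k (real d)"
          using nu_fun_below_nu[OF n 4(2) assms(1), of "real d"] 4 d by simp
        finally have "ln (2 / (c * \<eta>)) \<le> nu_fun n k (real d)" using A by simp
        hence "2 / (c * \<eta>) \<le> exp (nu_fun n k (real d))"
          using c assms by (subst (asm) exp_le_cancel_iff[symmetric]) simp
        hence "c * (2 / (c * \<eta>)) \<le> c * exp (nu_fun n k (real d))"
          using c by (intro mult_left_mono) auto
        also have "\<dots> \<le> real n * p"
          unfolding c_def
        proof (rule expected_exact_loads_ge[OF _ 4(2) k _ _ p_def])
          have "2 * (real d)\<^sup>2 \<le> 2 * (ln (real n))\<^sup>2"
            using dln by (intro mult_left_mono power_mono) auto
          also have "\<dots> \<le> exp (- 1 + ln (real n) / 2)" using elim by simp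
          also have "\<dots> \<le> exp (ln (real k))" using lnk by simp
          finally have "2 * (real d)\<^sup>2 \<le> real k" using 4 by simp
          thus "2 * d\<^sup>2 \<le> k" by (metis of_nat_le_iff of_nat_mult of_nat_numeral of_nat_power)
        qed (use elim 4 in auto)
        finally have np: "2 / \<eta> \<le> real n * p" using c by simp
        have "0 < 2 / \<eta>" using assms by simp
        hence np0: "0 < real n * p" using np by linarith
        hence "0 < p" using n by (simp add: zero_less_mult_iff)
        have "real (4 * d) \<le> real n" using elim dln by simp
        hence dn: "4 * d \<le> n" by (simp only: of_nat_le_iff)
        have "?P {a. \<forall>j\<in>{1..n}. bin_load k a j < d} \<le> ?P {a. \<forall>j\<in>{1..n}. bin_load k a j \<noteq> d}"
          by (intro measure_pmf.finite_measure_mono) auto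
        also have "\<dots> \<le> 1 / (real n * p) + 4 * real d / real n"
          by (rule prob_no_load_eq[OF _ dn p_def \<open>0 < p\<close>]) (use elim in simp)
        also have "\<dots> \<le> \<eta> / 2 + 4 * ln (real n) / real n"
        proof (rule add_mono)
          show "1 / (real n * p) \<le> \<eta> / 2"
            using np np0 assms by (simp add: field_simps)
          show "4 * real d / real n \<le> 4 * ln (real n) / real n"
            using dln by (intro divide_right_mono) auto
        qed
        finally show ?thesis using elim by linarith
      qed
    qed
  qed
qed

section \<open>Concentration of the maximum load and transfer to the graph\<close>

lemma eventually_max_load_concentrated:
  assumes "0 < \<epsilon>" "0 < \<eta>" "0 < C"
  shows "\<forall>\<^sub>F n in sequentially. \<forall>k. real k \<le> C * real n \<longrightarrow>
    measure_pmf.prob (map_pmf (loads n k) (balls_into_bins n k))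
      {z. \<not> (\<lfloor>nu n k - \<epsilon>\<rfloor> \<le> int (Max (z ` {1..n})) \<and> int (Max (z ` {1..n})) \<le> \<lfloor>nu n k + \<epsilon>\<rfloor>)} \<le> \<eta>"
proof -
  have \<eta>: "0 < \<eta> / 2" using assms by simp
  show ?thesis
    using eventually_max_load_le[OF assms(1) \<eta> assms(3)] eventually_max_load_ge[OF assms(1) \<eta> assms(3)]
      eventually_gt_at_top[of 0]
  proof eventually_elim
    case (elim n)
    show ?case
    proof (intro allI impI)
      fix k assume k: "real k \<le> C * real n"
      let ?P = "measure_pmf.prob (balls_into_bins n k)"
      \<comment> \<open>With a floor of at most 0 the lower bound is vacuous: then
        \<open>d = 0\<close> and \<open>L\<close> is empty because there are bins. The number
        \<open>e\<close> is the least load excluded from above.\<close>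
      define d where "d = nat \<lfloor>nu n k - \<epsilon>\<rfloor>"
      define e where "e = nat (\<lfloor>nu n k + \<epsilon>\<rfloor> + 1)"
      define U where "U = {a. \<exists>j\<in>{1..n}. e \<le> bin_load k a j}"
      define L where "L = {a. \<forall>j\<in>{1..n}. bin_load k a j < d}"
      have U: "?P U \<le> \<eta> / 2"
      proof -
        have "nu n k + \<epsilon> \<le> real e" unfolding e_def by linarith
        thus ?thesis unfolding U_def using elim(1) k by blast
      qed
      have L: "?P L \<le> \<eta> / 2"
      proof (cases "d = 0")
        case True
        hence "L = {}" using elim by (auto simp: L_def)
        thus ?thesis using \<eta> by simp
      next
        case False
        hence "real d \<le> nu n k - \<epsilon>" unfolding d_def by linarith
        thus ?thesis unfolding L_def using elim(2) k by blast
      qed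
      have sub: "loads n k -` {z. \<not> (\<lfloor>nu n k - \<epsilon>\<rfloor> \<le> int (Max (z ` {1..n})) \<and>
          int (Max (z ` {1..n})) \<le> \<lfloor>nu n k + \<epsilon>\<rfloor>)} \<subseteq> U \<union> L"
      proof
        fix a
        define M where "M = Max (loads n k a ` {1..n})"
        have ld: "loads n k a j = bin_load k a j" if "j \<in> {1..n}" for j
          using that by (simp add: loads_def bin_load_def)
        have "M \<in> loads n k a ` {1..n}" unfolding M_def using elim(3) by (intro Max_in) auto
        then obtain j where j: "j \<in> {1..n}" "M = bin_load k a j" using ld by auto
        have le: "bin_load k a i \<le> M" if "i \<in> {1..n}" for i
          unfolding M_def using that ld by (intro Max_ge) (auto simp flip: ld)
        assume "a \<in> loads n k -` {z. \<not> (\<lfloor>nu n k - \<epsilon>\<rfloor> \<le> int (Max (z ` {1..n})) \<and>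
          int (Max (z ` {1..n})) \<le> \<lfloor>nu n k + \<epsilon>\<rfloor>)}"
        hence "int M < \<lfloor>nu n k - \<epsilon>\<rfloor> \<or> \<lfloor>nu n k + \<epsilon>\<rfloor> < int M" by (auto simp: M_def)
        thus "a \<in> U \<union> L"
        proof
          assume "int M < \<lfloor>nu n k - \<epsilon>\<rfloor>"
          hence "M < d" by (simp add: d_def)
          hence "\<forall>j\<in>{1..n}. bin_load k a j < d" using le by (blast intro: le_less_trans)
          thus ?thesis by (simp add: L_def)
        next
          assume "\<lfloor>nu n k + \<epsilon>\<rfloor> < int M"
          hence "e \<le> M" by (simp add: e_def)
          thus ?thesis using j by (auto simp: U_def)
        qed
      qed
      have "?P (loads n k -` {z. \<not> (\<lfloor>nu n k - \<epsilon>\<rfloor> \<le> int (Max (z ` {1..n})) \<and>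
          int (Max (z ` {1..n})) \<le> \<lfloor>nu n k + \<epsilon>\<rfloor>)}) \<le> ?P (U \<union> L)"
        using sub by (intro measure_pmf.finite_measure_mono) auto
      also have "\<dots> \<le> ?P U + ?P L" by (rule measure_Un_le) auto
      also have "\<dots> \<le> \<eta>" using U L by simp
      finally show "measure_pmf.prob (map_pmf (loads n k) (balls_into_bins n k))
          {z. \<not> (\<lfloor>nu n k - \<epsilon>\<rfloor> \<le> int (Max (z ` {1..n})) \<and>
            int (Max (z ` {1..n})) \<le> \<lfloor>nu n k + \<epsilon>\<rfloor>)} \<le> \<eta>" by simp
    qed
  qed
qed

theorem theorem5p1:
  fixes m :: "nat \<Rightarrow> nat" and \<epsilon> :: real
  assumes "(\<lambda>n. real (m n)) \<in> O(\<lambda>n. real n)" and "\<epsilon> > 0"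
  shows "contiguous_wrt (\<lambda>n. {1..n} \<rightarrow>\<^sub>E {..2 * m n})
           (\<lambda>n. map_pmf (degree_sequence n) (gnm n (m n)))
           (\<lambda>n. map_pmf (loads n (2 * m n)) (balls_into_bins n (2 * m n))) \<and>
         (\<lambda>n. measure_pmf.prob (gnm n (m n))
           {G. \<lfloor>nu n (2 * m n) - \<epsilon>\<rfloor> \<le> int (max_degree n G) \<and>
               int (max_degree n G) \<le> \<lfloor>nu n (2 * m n) + \<epsilon>\<rfloor>}) \<longlonglongrightarrow> 1"
proof
  obtain C where C: "0 < C" "\<forall>\<^sub>F n in sequentially. norm (real (m n)) \<le> C * norm (real n)"
    using assms(1) by (rule landau_o.bigE)
  define K where "K = exp (2 * (1 + 2 * C) * C)"
  have K: "0 < K" by (simp add: K_def)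
  have "\<forall>\<^sub>F n in sequentially. 2 * (1 + 2 * C) \<le> real n" by real_asymp
  \<comment> \<open>The quantifier over \<open>A\<close> stands inside, so that the event may vary
    with \<open>n\<close>.\<close>
  hence dom: "\<forall>\<^sub>F n in sequentially. \<forall>A.
      measure_pmf.prob (map_pmf (degree_sequence n) (gnm n (m n))) A
        \<le> K * measure_pmf.prob (map_pmf (loads n (2 * m n)) (balls_into_bins n (2 * m n))) A"
    using C(2) eventually_gt_at_top[of 0]
  proof eventually_elim
    case (elim n)
    thus ?case unfolding K_def using C(1) by (intro allI degree_sequence_prob_le) auto
  qed
  show "contiguous_wrt (\<lambda>n. {1..n} \<rightarrow>\<^sub>E {..2 * m n})
      (\<lambda>n. map_pmf (degree_sequence n) (gnm n (m n)))
      (\<lambda>n. map_pmf (loads n (2 * m n)) (balls_into_bins n (2 * m n)))"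
    by (rule contiguous_wrtI_eventually_le[where K = K], rule eventually_mono[OF dom]) blast
  define good where "good = (\<lambda>n. {z. \<lfloor>nu n (2 * m n) - \<epsilon>\<rfloor> \<le> int (Max (z ` {1..n})) \<and>
      int (Max (z ` {1..n})) \<le> \<lfloor>nu n (2 * m n) + \<epsilon>\<rfloor>})"
  have eq: "measure_pmf.prob (gnm n (m n))
      {G. \<lfloor>nu n (2 * m n) - \<epsilon>\<rfloor> \<le> int (max_degree n G) \<and>
          int (max_degree n G) \<le> \<lfloor>nu n (2 * m n) + \<epsilon>\<rfloor>}
      = 1 - measure_pmf.prob (map_pmf (degree_sequence n) (gnm n (m n))) (- good n)" for n
  proof -
    have "degree_sequence n G ` {1..n} = degree G ` {1..n}" for G
      by (simp add: degree_sequence_def)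
    hence "{G. \<lfloor>nu n (2 * m n) - \<epsilon>\<rfloor> \<le> int (max_degree n G) \<and>
        int (max_degree n G) \<le> \<lfloor>nu n (2 * m n) + \<epsilon>\<rfloor>} = degree_sequence n -` good n"
      by (simp add: good_def max_degree_def vimage_def)
    thus ?thesis
      using measure_pmf.prob_compl[of "good n" "map_pmf (degree_sequence n) (gnm n (m n))"]
      by (simp add: Compl_eq_Diff_UNIV)
  qed
  have "(\<lambda>n. measure_pmf.prob (map_pmf (degree_sequence n) (gnm n (m n))) (- good n)) \<longlonglongrightarrow> 0"
  proof (rule tendstoI)
    fix \<eta> :: real assume \<eta>: "0 < \<eta>"
    \<comment> \<open>The bound for balls is \<open>2 * C\<close> as there are
      \<open>2 * m n\<close> of them; the tolerance \<open>\<eta> / (2 * K)\<close> becomes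
      \<open>\<eta> / 2\<close> after the domination by \<open>K\<close>.\<close>
    have C2: "0 < 2 * C" and \<eta>2: "0 < \<eta> / (2 * K)" using C \<eta> K by simp_all
    show "\<forall>\<^sub>F n in sequentially.
      dist (measure_pmf.prob (map_pmf (degree_sequence n) (gnm n (m n))) (- good n)) 0 < \<eta>"
      using dom C(2) eventually_max_load_concentrated[OF assms(2) \<eta>2 C2]
    proof eventually_elim
      case (elim n)
      have "real (2 * m n) \<le> 2 * C * real n" using elim(2) by simp
      hence "measure_pmf.prob (map_pmf (loads n (2 * m n)) (balls_into_bins n (2 * m n))) (- good n)
          \<le> \<eta> / (2 * K)"
        using elim(3) unfolding good_def Collect_neg_eq[symmetric] by blast
      hence "K * measure_pmf.prob (map_pmf (loads n (2 * m n)) (balls_into_bins n (2 * m n))) (- good n)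
          \<le> K * (\<eta> / (2 * K))"
        using K by (intro mult_left_mono) auto
      also have "\<dots> < \<eta>" using K \<eta> by simp
      finally show ?case using elim(1) by (smt (verit) dist_real_def measure_nonneg)
    qed
  qed
  hence "(\<lambda>n. 1 - measure_pmf.prob (map_pmf (degree_sequence n) (gnm n (m n))) (- good n)) \<longlonglongrightarrow> 1 - 0"
    by (intro tendsto_intros)
  thus "(\<lambda>n. measure_pmf.prob (gnm n (m n))
      {G. \<lfloor>nu n (2 * m n) - \<epsilon>\<rfloor> \<le> int (max_degree n G) \<and>
          int (max_degree n G) \<le> \<lfloor>nu n (2 * m n) + \<epsilon>\<rfloor>}) \<longlonglongrightarrow> 1"
    by (simp add: eq)
qed

end
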